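(* Consider two models as described in the context, with parameters $N,J,c,b_k,\alpha_k,\beta_k,d_j,\gamma_j$, operator $\mathcal A$ with eigenpairs $(\lambda_n,\varphi_n)$, observation functionals $B_1,B_2$, and $\tilde N,\tilde J,\tilde c,\tilde b_k,\tilde\alpha_k,\tilde\beta_k,\tilde d_j,\tilde\gamma_j$, operator $\tilde{\mathcal A}$ with eigenpairs $(\tilde\lambda_n,\tilde\varphi_n)$, observation functionals $\tilde B_1,\tilde B_2$. Let $f_1=\varphi_{n_1}$, $f_2=\varphi_{n_2}$, $\tilde f_1=\tilde\varphi_{\tilde n_1}$, $\tilde f_2=\tilde\varphi_{\tilde n_2}$ for some $n_1\ne n_2$, $\tilde n_1\neq\tilde n_2$ in $\mathbb N$. Suppose that the corresponding eigenvalues are known and equal, $\lambda_{n_i}=\tilde\lambda_{\tilde n_i}$, $i=1,2$, while the rest of $\mathcal A,\tilde{\mathcal A}$ is possibly unknown. For $i=1,2$ let $u_i$ be the solution, with vanishing initial data, of $$u_{tt}+c^2\mathcal A u+\sum_{j=1}^J d_j\partial_t^{2+\gamma_j}u+\sum_{k=1}^N b_k\partial_t^{\alpha_k}\mathcal A^{\beta_k}u=\sigma(t)f_i ,$$ and let $\tilde u_i$ be the solution, with vanishing initial data, of the corresponding equation with $\tilde c,\tilde{\mathcal A},\tilde f_i$ and the tilde parameters. If $$B_iu_i(t)=\tilde B_i\tilde u_i(t),\qquad t\in(0,T),\ i=1,2,$$ then $$N=\tilde N,\ J=\tilde J,\ c=\tilde c,\ b_k=\tilde b_k,\ \alpha_k=\tilde\alpha_k,\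 \beta_k=\tilde\beta_k,\ d_j=\tilde d_j,\ \gamma_j=\tilde\gamma_j,\quad k\in\{1,\dots,N\},\ j\in\{1,\dots,J\}.$$
   Context: $\Omega\subseteq\mathbb R^d$, $T>0$. $\partial_t^\alpha$ is the Caputo–Djrbashian derivative, $\partial_t^\alpha u(t)=\frac{1}{\Gamma(n-\alpha)}\int_0^t (t-s)^{n-\alpha-1}\partial_t^nu(s)\,ds$ for $\alpha\in(n-1,n)$ (usual derivative for integer $\alpha$). Orders and coefficients: $c$ is a constant wave speed, $0<\alpha_1<\cdots<\alpha_N\le1$, $0<\gamma_1<\cdots<\gamma_J\le1$, $\beta_k\in(\frac12,1]$, with constant coefficients $b_k$, $d_j$, and likewise for the tilde parameters. $\mathcal A=-\mathbb L$, with $\mathbb L$ an elliptic differential operator on $\Omega$ with homogeneous Dirichlet/Neumann/impedance boundary conditions, has eigenvalues $\lambda_n$ and $L^2(\Omega)$-normalised eigenfunctions $\varphi_n$; analogously $\tilde{\mathcal A}$, $\tilde\lambda_n$, $\tilde\varphi_n$. The temporal part $\sigma$ of the source is the same in all experiments, and its Laplace transform vanishes nowhere. $B_i,\tilde B_i$ are observation operators acting on functions of $x$, e.g. point evaluation or a weighted integral; $B_iu_i(t)$ means $B_i$ applied to $u_i(\cdot,t)$. The observations satisfy $B_i\varphi_{n_i}\neq0$ and $\tilde B_i\tilde\varphi_{\tilde n_i}\ne0$, $i=1,2$.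
   Formalization: Added, as the claim fails otherwise: all b_k, d_j (and tilde) nonzero; λ_{n_1}≠λ_{n_2}, not just n_1≠n_2; λ_{n_i}>0; σ not a.e. zero on (0,T). Also c>0; 𝒜 is read as symmetric second order in divergence form, with a complete orthonormal eigensystem and λ_n≥0. *)

theory Defs
  imports "HOL-Analysis.Analysis"
begin

section \<open>Square-integrable functions\<close>

text \<open>Functions are not quotiented by equality almost everywhere.\<close>

definition L2 :: "'x measure \<Rightarrow> ('x \<Rightarrow> 'b::euclidean_space) set" where
  "L2 M = {v \<in> borel_measurable M. integrable M (\<lambda>x. (norm (v x))\<^sup>2)}"

definition inner_L2 :: "'x measure \<Rightarrow> ('x \<Rightarrow> 'b::euclidean_space) \<Rightarrow> ('x \<Rightarrow> 'b) \<Rightarrow> real" where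
  "inner_L2 M v w = (LINT x|M. v x \<bullet> w x)"

definition converges_L2 ::
  "'x measure \<Rightarrow> (nat \<Rightarrow> 'x \<Rightarrow> 'b::euclidean_space) \<Rightarrow> ('x \<Rightarrow> 'b) \<Rightarrow> bool" where
  "converges_L2 M \<psi> v \<longleftrightarrow> v \<in> L2 M \<and> (\<forall>k. \<psi> k \<in> L2 M) \<and>
     (\<lambda>k. LINT x|M. (norm (\<psi> k x - v x))\<^sup>2) \<longlonglongrightarrow> 0"


section \<open>Weak derivatives and the boundary measure\<close>

definition grad :: "(real^'d \<Rightarrow> real) \<Rightarrow> real^'d \<Rightarrow> real^'d" where
  "grad \<psi> x = (\<chi> i. frechet_derivative \<psi> (at x) (axis i 1))"

definition C1_functions :: "(real^'d \<Rightarrow> real) set" where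
  "C1_functions = {\<psi>. (\<forall>x. \<psi> differentiable at x) \<and> continuous_on UNIV (grad \<psi>)}"

definition test_functions :: "(real^'d) set \<Rightarrow> (real^'d \<Rightarrow> real) set" where
  "test_functions \<Omega> =
     {\<psi> \<in> C1_functions. \<exists>K. compact K \<and> K \<subseteq> \<Omega> \<and> (\<forall>x. x \<notin> K \<longrightarrow> \<psi> x = 0)}"

definition weak_gradient ::
  "(real^'d) set \<Rightarrow> (real^'d \<Rightarrow> real) \<Rightarrow> (real^'d \<Rightarrow> real^'d) \<Rightarrow> bool" where
  "weak_gradient \<Omega> v G \<longleftrightarrow> G \<in> L2 (lebesgue_on \<Omega>) \<and>
     (\<forall>\<psi>\<in>test_functions \<Omega>.
        (LINT x|lebesgue_on \<Omega>. v x *\<^sub>R grad \<psi> x) = - (LINT x|lebesgue_on \<Omega>. \<psi> x *\<^sub>R G x))"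

text \<open>
  The \<open>m\<close>-dimensional Hausdorff measure on Borel sets, normalised to agree with the surface
  measure. The case distinction on the empty set matters for \<open>m = 0\<close> (counting measure),
  where \<open>0 ^ 0 = 1\<close>.
\<close>

definition hausdorff_premeasure :: "nat \<Rightarrow> real \<Rightarrow> (real^'d) set \<Rightarrow> ennreal" where
  "hausdorff_premeasure m \<delta> S =
     (INF C \<in> {C :: nat \<Rightarrow> (real^'d) set.
                 S \<subseteq> (\<Union>i. C i) \<and> (\<forall>i. bounded (C i) \<and> diameter (C i) \<le> \<delta>)}.
        (\<Sum>i. if C i = {} then 0
              else ennreal (unit_ball_vol (real m) * (diameter (C i) / 2) ^ m)))"

definition hausdorff_measure :: "nat \<Rightarrow> (real^'d) measure" where
  "hausdorff_measure m =
     measure_of UNIV (sets borel) (\<lambda>S. SUP \<delta>\<in>{0<..}. hausdorff_premeasure m \<delta> S)"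

definition boundary_measure :: "(real^'d) set \<Rightarrow> (real^'d) measure" where
  "boundary_measure \<Omega> = restrict_space (hausdorff_measure (CARD('d) - 1)) (frontier \<Omega>)"


section \<open>Elliptic operators with homogeneous boundary conditions\<close>

text \<open>
  The operator is \<open>\<A> = - \<L>\<close>, where \<open>\<L> v = div (a grad v) - q v\<close> in \<open>\<Omega>\<close>, with one of
  the boundary conditions \<open>v = 0\<close> (Dirichlet), \<open>\<nu> \<bullet> a grad v = 0\<close> (Neumann) or
  \<open>\<nu> \<bullet> a grad v + \<kappa> v = 0\<close> (impedance) on the boundary, \<open>\<nu>\<close> being the outer unit normal.
  It is realised in L2 by its bilinear form, so that no smoothness of the coefficients
  or of the eigenfunctions is needed.
\<close>

datatype 'd boundary_condition = Dirichlet | Neumann | Impedance "real^'d \<Rightarrow> real"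

definition elliptic_coefficients ::
  "(real^'d) set \<Rightarrow> (real^'d \<Rightarrow> real^'d^'d) \<Rightarrow> (real^'d \<Rightarrow> real) \<Rightarrow> 'd boundary_condition \<Rightarrow> bool"
where
  "elliptic_coefficients \<Omega> a q bc \<longleftrightarrow>
     a \<in> borel_measurable (lebesgue_on \<Omega>) \<and> bounded (a ` \<Omega>) \<and>
     (\<forall>x\<in>\<Omega>. transpose (a x) = a x) \<and>
     (\<exists>\<theta>>0. \<forall>x\<in>\<Omega>. \<forall>\<xi>. \<theta> * (norm \<xi>)\<^sup>2 \<le> \<xi> \<bullet> (a x *v \<xi>)) \<and>
     q \<in> borel_measurable (lebesgue_on \<Omega>) \<and> bounded (q ` \<Omega>) \<and>
     (case bc of
        Impedance \<kappa> \<Rightarrow> \<kappa> \<in> borel_measurable (boundary_measure \<Omega>) \<and> bounded (\<kappa> ` frontier \<Omega>)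
      | _ \<Rightarrow> True)"

text \<open>
  \<open>form_domain bc \<Omega> v G h\<close>: the function \<open>v\<close> belongs to the form domain and has weak gradient
  \<open>G\<close>; for the impedance condition \<open>h\<close> is its boundary trace, otherwise \<open>h\<close> is irrelevant.
\<close>

definition form_domain ::
  "'d boundary_condition \<Rightarrow> (real^'d) set \<Rightarrow>
     (real^'d \<Rightarrow> real) \<Rightarrow> (real^'d \<Rightarrow> real^'d) \<Rightarrow> (real^'d \<Rightarrow> real) \<Rightarrow> bool"
where
  "form_domain bc \<Omega> v G h \<longleftrightarrow> v \<in> L2 (lebesgue_on \<Omega>) \<and> weak_gradient \<Omega> v G \<and>
     (case bc of
        Dirichlet \<Rightarrow>
          (\<exists>\<psi>. (\<forall>k. \<psi> k \<in> test_functions \<Omega>) \<and>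
               converges_L2 (lebesgue_on \<Omega>) \<psi> v \<and>
               converges_L2 (lebesgue_on \<Omega>) (\<lambda>k. grad (\<psi> k)) G)
      | Neumann \<Rightarrow> True
      | Impedance \<kappa> \<Rightarrow>
          (\<exists>\<psi>. (\<forall>k. \<psi> k \<in> C1_functions) \<and>
               converges_L2 (lebesgue_on \<Omega>) \<psi> v \<and>
               converges_L2 (lebesgue_on \<Omega>) (\<lambda>k. grad (\<psi> k)) G \<and>
               converges_L2 (boundary_measure \<Omega>) \<psi> h))"

definition elliptic_form ::
  "(real^'d) set \<Rightarrow> (real^'d \<Rightarrow> real^'d^'d) \<Rightarrow> (real^'d \<Rightarrow> real) \<Rightarrow> 'd boundary_condition \<Rightarrow>
     (real^'d \<Rightarrow> real) \<Rightarrow> (real^'d \<Rightarrow> real^'d) \<Rightarrow> (real^'d \<Rightarrow> real) \<Rightarrow>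
     (real^'d \<Rightarrow> real) \<Rightarrow> (real^'d \<Rightarrow> real^'d) \<Rightarrow> (real^'d \<Rightarrow> real) \<Rightarrow> real"
where
  "elliptic_form \<Omega> a q bc v G h w H l =
     (LINT x|lebesgue_on \<Omega>. (a x *v G x) \<bullet> H x + q x * v x * w x) +
     (case bc of
        Impedance \<kappa> \<Rightarrow> (LINT x|boundary_measure \<Omega>. \<kappa> x * h x * l x)
      | _ \<Rightarrow> 0)"

text \<open>
  \<open>elliptic_operator \<Omega> a q bc v g\<close>: the function \<open>v\<close> is in the operator domain of \<open>\<A>\<close> and
  \<open>\<A> v = g\<close>.
\<close>

definition elliptic_operator ::
  "(real^'d) set \<Rightarrow> (real^'d \<Rightarrow> real^'d^'d) \<Rightarrow> (real^'d \<Rightarrow> real) \<Rightarrow> 'd boundary_condition \<Rightarrow>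
     (real^'d \<Rightarrow> real) \<Rightarrow> (real^'d \<Rightarrow> real) \<Rightarrow> bool"
where
  "elliptic_operator \<Omega> a q bc v g \<longleftrightarrow> g \<in> L2 (lebesgue_on \<Omega>) \<and>
     (\<exists>G h. form_domain bc \<Omega> v G h \<and>
        (\<forall>w H l. form_domain bc \<Omega> w H l \<longrightarrow>
           elliptic_form \<Omega> a q bc v G h w H l = inner_L2 (lebesgue_on \<Omega>) g w))"

text \<open>
  A complete orthonormal system of eigenfunctions; eigenvalues are repeated according to
  multiplicity. They are nonnegative, so that the powers of \<open>\<A>\<close> make sense.
\<close>

definition eigensystem ::
  "(real^'d) set \<Rightarrow> ((real^'d \<Rightarrow> real) \<Rightarrow> (real^'d \<Rightarrow> real) \<Rightarrow> bool) \<Rightarrow>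
     (nat \<Rightarrow> real) \<Rightarrow> (nat \<Rightarrow> real^'d \<Rightarrow> real) \<Rightarrow> bool"
where
  "eigensystem \<Omega> \<A> lam \<phi> \<longleftrightarrow>
     (\<forall>n. 0 \<le> lam n \<and> \<phi> n \<in> L2 (lebesgue_on \<Omega>) \<and> \<A> (\<phi> n) (\<lambda>x. lam n * \<phi> n x)) \<and>
     (\<forall>m n. inner_L2 (lebesgue_on \<Omega>) (\<phi> m) (\<phi> n) = (if m = n then 1 else 0)) \<and>
     (\<forall>v\<in>L2 (lebesgue_on \<Omega>).
        (\<forall>n. inner_L2 (lebesgue_on \<Omega>) v (\<phi> n) = 0) \<longrightarrow> (AE x in lebesgue_on \<Omega>. v x = 0))"

text \<open>
  \<open>spectral_power \<Omega> lam \<phi> \<beta> v g\<close>: the function \<open>v\<close> is in the domain of \<open>\<A>\<^sup>\<beta>\<close> and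
  \<open>\<A>\<^sup>\<beta> v = g\<close>, the power being defined by the eigenfunction expansion.
\<close>

definition spectral_power ::
  "(real^'d) set \<Rightarrow> (nat \<Rightarrow> real) \<Rightarrow> (nat \<Rightarrow> real^'d \<Rightarrow> real) \<Rightarrow> real \<Rightarrow>
     (real^'d \<Rightarrow> real) \<Rightarrow> (real^'d \<Rightarrow> real) \<Rightarrow> bool"
where
  "spectral_power \<Omega> lam \<phi> \<beta> v g \<longleftrightarrow> v \<in> L2 (lebesgue_on \<Omega>) \<and> g \<in> L2 (lebesgue_on \<Omega>) \<and>
     (\<forall>n. inner_L2 (lebesgue_on \<Omega>) g (\<phi> n) = lam n powr \<beta> * inner_L2 (lebesgue_on \<Omega>) v (\<phi> n))"


section \<open>Fractional derivatives in time\<close>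

text \<open>The Caputo--Djrbashian derivative of order \<open>\<alpha>\<close>, for \<open>\<alpha> > 0\<close>.\<close>

definition caputo :: "real \<Rightarrow> (real \<Rightarrow> real) \<Rightarrow> real \<Rightarrow> real" where
  "caputo \<alpha> w t =
     (let n = nat \<lceil>\<alpha>\<rceil> in
      if real n = \<alpha> then (deriv ^^ n) w t
      else 1 / Gamma (real n - \<alpha>) *
        (LINT s|lebesgue_on {0<..<t}. (t - s) powr (real n - \<alpha> - 1) * (deriv ^^ n) w s))"

text \<open>
  \<open>w\<close> and its derivatives of order less than \<open>n\<close> are absolutely continuous on \<open>[0, \<tau>]\<close> for each
  \<open>\<tau> < T\<close>, so that the derivative of order \<open>n\<close> exists almost everywhere and is integrable on
  \<open>(0, \<tau>)\<close>.
\<close>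

definition time_regular :: "nat \<Rightarrow> real \<Rightarrow> (real \<Rightarrow> real) \<Rightarrow> bool" where
  "time_regular n T w \<longleftrightarrow>
     (\<forall>k<n. \<forall>t\<in>{0<..<T}.
        integrable (lebesgue_on {0<..<t}) ((deriv ^^ Suc k) w) \<and>
        (\<forall>r\<in>{0<..<t}.
           (deriv ^^ k) w t - (deriv ^^ k) w r = (LINT s|lebesgue_on {r<..<t}. (deriv ^^ Suc k) w s)))"

definition vanishing_initial_data :: "nat \<Rightarrow> (real \<Rightarrow> real) \<Rightarrow> bool" where
  "vanishing_initial_data n w \<longleftrightarrow> (\<forall>k<n. ((deriv ^^ k) w \<longlongrightarrow> 0) (at_right 0))"


section \<open>The damped wave equation\<close>

definition damping_parameters ::
  "nat \<Rightarrow> nat \<Rightarrow> real \<Rightarrow> (nat \<Rightarrow> real) \<Rightarrow> (nat \<Rightarrow> real) \<Rightarrow> (nat \<Rightarrow> real) \<Rightarrow>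
     (nat \<Rightarrow> real) \<Rightarrow> (nat \<Rightarrow> real) \<Rightarrow> bool"
where
  "damping_parameters N J c b \<alpha> \<beta> d \<gamma> \<longleftrightarrow>
     0 < c \<and>
     (\<forall>k\<in>{1..N}. b k \<noteq> 0 \<and> 0 < \<alpha> k \<and> \<alpha> k \<le> 1 \<and> 1/2 < \<beta> k \<and> \<beta> k \<le> 1) \<and>
     strict_mono_on {1..N} \<alpha> \<and>
     (\<forall>j\<in>{1..J}. d j \<noteq> 0 \<and> 0 < \<gamma> j \<and> \<gamma> j \<le> 1) \<and>
     strict_mono_on {1..J} \<gamma>"

text \<open>
  \<open>u\<close> solves, on \<open>(0, T)\<close> and with vanishing initial data,
  \<open>u\<^sub>t\<^sub>t + c\<^sup>2 \<A> u + (\<Sum>j\<le>J. d\<^sub>j \<partial>\<^sub>t\<^bsup>2 + \<gamma>\<^sub>j\<^esup> u) + (\<Sum>k\<le>N. b\<^sub>k \<partial>\<^sub>t\<^bsup>\<alpha>\<^sub>k\<^esup> \<A>\<^bsup>\<beta>\<^sub>k\<^esup> u) = \<sigma>(t) f\<close>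
  in the weak sense in space: the equation is tested with the elements \<open>v\<close> of the domain of the
  self-adjoint operator \<open>\<A>\<close>, with \<open>\<A>\<close> and its powers moved onto \<open>v\<close>. Without the terms of
  order \<open>2 + \<gamma>\<^sub>j\<close> the equation is of second order in time and \<open>u\<close>, \<open>u\<^sub>t\<close> are prescribed at
  \<open>t = 0\<close>; with them also \<open>u\<^sub>t\<^sub>t\<close> is.
\<close>

definition damped_wave_solution ::
  "(real^'d) set \<Rightarrow> ((real^'d \<Rightarrow> real) \<Rightarrow> (real^'d \<Rightarrow> real) \<Rightarrow> bool) \<Rightarrow>
     (nat \<Rightarrow> real) \<Rightarrow> (nat \<Rightarrow> real^'d \<Rightarrow> real) \<Rightarrow>
     nat \<Rightarrow> nat \<Rightarrow> real \<Rightarrow> (nat \<Rightarrow> real) \<Rightarrow> (nat \<Rightarrow> real) \<Rightarrow> (nat \<Rightarrow> real) \<Rightarrow>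
     (nat \<Rightarrow> real) \<Rightarrow> (nat \<Rightarrow> real) \<Rightarrow>
     real \<Rightarrow> (real \<Rightarrow> real) \<Rightarrow> (real^'d \<Rightarrow> real) \<Rightarrow> (real \<Rightarrow> real^'d \<Rightarrow> real) \<Rightarrow> bool"
where
  "damped_wave_solution \<Omega> \<A> lam \<phi> N J c b \<alpha> \<beta> d \<gamma> T \<sigma> f u \<longleftrightarrow>
     (\<forall>t\<in>{0<..<T}. u t \<in> L2 (lebesgue_on \<Omega>)) \<and>
     (\<forall>v\<in>L2 (lebesgue_on \<Omega>).
        let n = (if J = 0 then 2 else 3); w = (\<lambda>t. inner_L2 (lebesgue_on \<Omega>) (u t) v)
        in time_regular n T w \<and> vanishing_initial_data n w) \<and>
     (\<forall>v g h. \<A> v g \<longrightarrow> (\<forall>k\<in>{1..N}. spectral_power \<Omega> lam \<phi> (\<beta> k) v (h k)) \<longrightarrow>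
        (AE t in lebesgue_on {0<..<T}.
           (deriv ^^ 2) (\<lambda>s. inner_L2 (lebesgue_on \<Omega>) (u s) v) t
           + c\<^sup>2 * inner_L2 (lebesgue_on \<Omega>) (u t) g
           + (\<Sum>j=1..J. d j * caputo (2 + \<gamma> j) (\<lambda>s. inner_L2 (lebesgue_on \<Omega>) (u s) v) t)
           + (\<Sum>k=1..N. b k * caputo (\<alpha> k) (\<lambda>s. inner_L2 (lebesgue_on \<Omega>) (u s) (h k)) t)
           = \<sigma> t * inner_L2 (lebesgue_on \<Omega>) f v))"


section \<open>Sources and observations\<close>

text \<open>
  The Laplace transform is considered on its domain of absolute convergence, which is required
  to be nonempty.
\<close>

definition laplace_integrand :: "(real \<Rightarrow> real) \<Rightarrow> complex \<Rightarrow> real \<Rightarrow> complex" where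
  "laplace_integrand \<sigma> s t = exp (- s * of_real t) * of_real (\<sigma> t)"

definition laplace_domain :: "(real \<Rightarrow> real) \<Rightarrow> complex set" where
  "laplace_domain \<sigma> = {s. integrable (lebesgue_on {0<..}) (laplace_integrand \<sigma> s)}"

definition laplace_transform :: "(real \<Rightarrow> real) \<Rightarrow> complex \<Rightarrow> complex" where
  "laplace_transform \<sigma> s = (LINT t|lebesgue_on {0<..}. laplace_integrand \<sigma> s t)"

definition laplace_nonvanishing :: "(real \<Rightarrow> real) \<Rightarrow> bool" where
  "laplace_nonvanishing \<sigma> \<longleftrightarrow>
     laplace_domain \<sigma> \<noteq> {} \<and> (\<forall>s\<in>laplace_domain \<sigma>. laplace_transform \<sigma> s \<noteq> 0)"

text \<open>
  A linear functional \<open>B\<close> on a subspace \<open>D\<close> of L2, respecting equality almost everywhere.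
  Point evaluation at \<open>x\<^sub>0\<close> is covered: \<open>D\<close> consists of the functions having a continuous
  representative, which is then evaluated at \<open>x\<^sub>0\<close>.
\<close>

definition observation_functional ::
  "(real^'d) set \<Rightarrow> (real^'d \<Rightarrow> real) set \<Rightarrow> ((real^'d \<Rightarrow> real) \<Rightarrow> real) \<Rightarrow> bool"
where
  "observation_functional \<Omega> D B \<longleftrightarrow> D \<subseteq> L2 (lebesgue_on \<Omega>) \<and>
     (\<forall>v\<in>D. \<forall>w\<in>D. (\<lambda>x. v x + w x) \<in> D \<and> B (\<lambda>x. v x + w x) = B v + B w) \<and>
     (\<forall>v\<in>D. \<forall>r. (\<lambda>x. r * v x) \<in> D \<and> B (\<lambda>x. r * v x) = r * B v) \<and>
     (\<forall>v\<in>D. \<forall>w. (AE x in lebesgue_on \<Omega>. w x = v x) \<longrightarrow> w \<in> D \<and> B w = B v)"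

end

theory Submission
  imports Defs
begin

text \<open>
  Testing the equation with the eigenfunctions reduces it to scalar fractional differential
  equations on \<open>(0, T)\<close>. Such an equation with nonzero symbol, zero right-hand side and
  vanishing initial data has only the zero solution: integrated sufficiently often it becomes a
  Volterra equation of the second kind with weakly singular kernel, which is a contraction in an
  exponentially weighted norm. Hence \<open>u\<^sub>i(t) = w\<^sub>i(t) \<phi>\<^bsub>n\<^sub>i\<^esub>\<close>, and equality of the observations
  means that \<open>w\<^sub>i\<close> and its counterpart in the other model are proportional. Subtracting the two
  scalar equations for them gives a homogeneous equation with the nonzero solution \<open>w\<^sub>i\<close>, so the
  two symbols are proportional as functions of the order, and the coefficient 1 at order 2 makes
  them equal. The coefficients \<open>b\<^sub>k \<lambda>\<^bsup>\<beta>\<^sub>k\<^esup>\<close> for two different eigenvalues finally determine \<open>b\<^sub>k\<close>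
  and \<open>\<beta>\<^sub>k\<close>.
\<close>


section \<open>Riemann--Liouville integrals\<close>

text \<open>Extended by zero to x \<le> 0, so that integrals over the whole line of
  \<open>rl_kernel a (t - s)\<close> and \<open>rl_kernel b s\<close> are cut off at the right
  limits, and translations and scalings need no change of domain.\<close>

definition rl_kernel :: "real \<Rightarrow> real \<Rightarrow> real" where
  "rl_kernel a x = (if 0 < x then x powr (a - 1) / Gamma a else 0)"

section \<open>Kernels of fractional integration: convolution, Laplace transform, Fubini\<close>

lemma rl_kernel_measurable [measurable]: "rl_kernel a \<in> borel_measurable borel"
  unfolding rl_kernel_def by measurable

lemma rl_kernel_nonneg: "0 < a \<Longrightarrow> 0 \<le> rl_kernel a x"
  by (simp add: rl_kernel_def Gamma_real_pos less_imp_le)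

lemma Gamma_pos_nonzero: "0 < a \<Longrightarrow> Gamma (a::real) \<noteq> 0"
  using Gamma_real_pos[of a] by linarith

lemma rl_kernel_scale: "0 < x \<Longrightarrow> rl_kernel a (x * y) = x powr (a - 1) * rl_kernel a y"
  by (auto simp: rl_kernel_def powr_mult zero_less_mult_iff)

text \<open>This is Euler's Beta integral with
  \<open>Beta b a = Gamma a * Gamma b / Gamma (a + b)\<close>.\<close>

lemma rl_kernel_convolution_one:
  assumes "0 < a" "0 < b"
  shows "has_bochner_integral lborel (\<lambda>s. rl_kernel a (1 - s) * rl_kernel b s) (1 / Gamma (a + b))"
proof -
  let ?f = "\<lambda>t. t powr (b - 1) * (1 - t) powr (a - 1)"
  have I: "set_integrable lborel {0..1} ?f"
    using integrable_Beta[of b a] assms by simp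
  have "(LINT t:{0..1}|lborel. ?f t) = Beta b a"
    using set_borel_integral_eq_integral(2)[OF I] has_integral_Beta_real[of b a] assms
    by (simp add: integral_unique)
  then have "has_bochner_integral lborel (\<lambda>t. indicator {0..1} t *\<^sub>R ?f t) (Beta b a)"
    using I unfolding has_bochner_integral_iff set_integrable_def set_lebesgue_integral_def by simp
  then have "has_bochner_integral lborel
      (\<lambda>t. indicator {0..1} t *\<^sub>R ?f t / (Gamma a * Gamma b)) (Beta b a / (Gamma a * Gamma b))"
    by (rule has_bochner_integral_divide)
  moreover have "Gamma a \<noteq> 0" "Gamma b \<noteq> 0"
    using Gamma_pos_nonzero assms by blast+
  then have "Beta b a / (Gamma a * Gamma b) = 1 / Gamma (a + b)"
    by (simp add: Beta_def add.commute)
  \<comment> \<open>The closed interval agrees with the open support of the kernels even at the end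
    points, because \<open>0 powr x = 0\<close>.\<close>
  moreover have "(\<lambda>t. indicator {0..1} t *\<^sub>R ?f t / (Gamma a * Gamma b)) =
      (\<lambda>s. rl_kernel a (1 - s) * rl_kernel b s)"
    by (auto simp: fun_eq_iff rl_kernel_def indicator_def)
  ultimately show ?thesis by simp
qed

text \<open>For x > 0 the substitution s to x * s reduces the integral to the case x = 1, since the
  kernels are homogeneous.\<close>

lemma rl_kernel_convolution:
  assumes "0 < a" "0 < b"
  shows "has_bochner_integral lborel (\<lambda>s. rl_kernel a (x - s) * rl_kernel b s) (rl_kernel (a + b) x)"
proof (cases "0 < x")
  case True
  have "has_bochner_integral lborel (\<lambda>s. rl_kernel a (x - (0 + x * s)) * rl_kernel b (0 + x * s))
     (x powr (a - 1) * x powr (b - 1) * (1 / Gamma (a + b)))"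
  proof (rule has_bochner_integral_cong[THEN iffD2, OF refl _ refl])
    show "has_bochner_integral lborel
       (\<lambda>s. x powr (a - 1) * x powr (b - 1) * (rl_kernel a (1 - s) * rl_kernel b s))
       (x powr (a - 1) * x powr (b - 1) * (1 / Gamma (a + b)))"
      by (intro has_bochner_integral_mult_right rl_kernel_convolution_one assms)
    show "rl_kernel a (x - (0 + x * s)) * rl_kernel b (0 + x * s) =
       x powr (a - 1) * x powr (b - 1) * (rl_kernel a (1 - s) * rl_kernel b s)" for s
      using rl_kernel_scale[OF True, of a "1 - s"] rl_kernel_scale[OF True, of b s]
      by (simp add: right_diff_distrib)
  qed
  \<comment> \<open>The quotient by x is the Jacobian of the substitution.\<close>
  moreover have "x powr (a - 1) * x powr (b - 1) * (1 / Gamma (a + b)) = rl_kernel (a + b) x / x"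
    using True by (simp add: rl_kernel_def powr_diff powr_add field_simps)
  ultimately show ?thesis
    using True lborel_has_bochner_integral_real_affine_iff[of x
       "\<lambda>s. rl_kernel a (x - s) * rl_kernel b s" "rl_kernel (a + b) x" 0]
    by (simp add: divide_inverse mult.commute)
next
  case False
  then have "(\<lambda>s. rl_kernel a (x - s) * rl_kernel b s) = (\<lambda>s. 0)" "rl_kernel (a + b) x = 0"
    by (auto simp: rl_kernel_def fun_eq_iff)
  then show ?thesis by (simp add: has_bochner_integral_zero)
qed

text \<open>Euler's integral for Gamma after the substitution x to l * x. The decay of
  \<open>l powr - a\<close> for large l later makes the Volterra operators contractions.\<close>

lemma rl_kernel_laplace:
  assumes "0 < a" "0 < l"
  shows "has_bochner_integral lborel (\<lambda>x. rl_kernel a x * exp (- l * x)) (l powr - a)"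
proof -
  let ?g = "\<lambda>x. if x \<in> {0..} then x powr (a - 1) / exp x else 0"
  have "(?g has_integral Gamma a) UNIV"
    using Gamma_integral_real[OF assms(1)] by (simp only: has_integral_restrict_UNIV)
  then have "integral\<^sup>N lborel ?g = Gamma a"
    by (intro nn_integral_has_integral_lborel) auto
  then have "has_bochner_integral lborel ?g (Gamma a)"
    using Gamma_real_pos[OF assms(1)]
    by (intro has_bochner_integral_nn_integral) auto
  then have "has_bochner_integral lborel (\<lambda>x. ?g (0 + l * x)) (Gamma a /\<^sub>R \<bar>l\<bar>)"
    using lborel_has_bochner_integral_real_affine_iff[of l ?g "Gamma a" 0] assms by simp
  then have "has_bochner_integral lborel (\<lambda>x. ?g (0 + l * x) * (l powr (1 - a) / Gamma a))
     (Gamma a /\<^sub>R \<bar>l\<bar> * (l powr (1 - a) / Gamma a))"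
    by (rule has_bochner_integral_mult_left)
  moreover have "Gamma a /\<^sub>R \<bar>l\<bar> * (l powr (1 - a) / Gamma a) = l powr - a"
    using Gamma_pos_nonzero[OF assms(1)] assms by (simp add: powr_diff powr_minus field_simps)
  moreover have "?g (0 + l * x) * (l powr (1 - a) / Gamma a) = rl_kernel a x * exp (- l * x)" for x
  proof -
    have "l powr (a - 1) * l powr (1 - a) = 1"
      using assms by (simp flip: powr_add)
    then show ?thesis using assms
      by (auto simp: rl_kernel_def powr_mult exp_minus field_simps zero_le_mult_iff)
  qed
  ultimately show ?thesis by simp
qed

text \<open>The kernels are nonnegative, so the inner integral of the absolute value is again given
  by the convolution formula; integrability of the composed kernel against g is therefore enough for
  Fubini.\<close>

lemma rl_kernel_fubini:
  assumes a: "0 < a" and b: "0 < b" and g [measurable]: "g \<in> borel_measurable borel"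
    and int: "integrable lborel (\<lambda>r. rl_kernel (a + b) (t - r) * g r)"
  shows "has_bochner_integral lborel
    (\<lambda>s. rl_kernel a (t - s) * (LINT r|lborel. rl_kernel b (s - r) * g r))
    (LINT r|lborel. rl_kernel (a + b) (t - r) * g r)"
proof -
  let ?F = "\<lambda>r s. rl_kernel a (t - s) * rl_kernel b (s - r) * g r"
  have conv: "has_bochner_integral lborel (\<lambda>s. rl_kernel a (t - s) * rl_kernel b (s - r))
      (rl_kernel (a + b) (t - r))" for r
    using lborel_has_bochner_integral_real_affine_iff[of 1
        "\<lambda>s. rl_kernel a (t - s) * rl_kernel b (s - r)" "rl_kernel (a + b) (t - r)" r]
      rl_kernel_convolution[OF a b, of "t - r"]
    by (simp add: algebra_simps)
  have I: "has_bochner_integral lborel (\<lambda>s. ?F r s) (rl_kernel (a + b) (t - r) * g r)" for r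
    by (intro has_bochner_integral_mult_left conv)
  have A: "has_bochner_integral lborel (\<lambda>s. norm (?F r s)) (rl_kernel (a + b) (t - r) * \<bar>g r\<bar>)" for r
    using has_bochner_integral_mult_left[OF conv, of r "\<bar>g r\<bar>"]
    by (simp add: abs_mult rl_kernel_nonneg a b)
  have n: "0 \<le> rl_kernel (a + b) x" for x
    using a b by (intro rl_kernel_nonneg) simp
  have "integrable (lborel \<Otimes>\<^sub>M lborel) (\<lambda>(r, s). ?F r s)"
  proof (rule lborel_pair.Fubini_integrable)
    have "integrable lborel (\<lambda>r. rl_kernel (a + b) (t - r) * \<bar>g r\<bar>)"
      using integrable_norm[OF int] n by (simp add: abs_mult)
    then show "integrable lborel (\<lambda>r. LINT s|lborel. norm (case (r, s) of (r, s) \<Rightarrow> ?F r s))"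
      by (simp add: has_bochner_integral_integral_eq[OF A] del: real_norm_def)
    show "AE r in lborel. integrable lborel (\<lambda>s. case (r, s) of (r, s) \<Rightarrow> ?F r s)"
      using I by (auto simp: has_bochner_integral_iff)
  qed measurable
  from lborel_pair.integrable_snd[OF this] lborel_pair.Fubini_integral[OF this]
  have "has_bochner_integral lborel (\<lambda>s. LINT r|lborel. ?F r s) (LINT r|lborel. LINT s|lborel. ?F r s)"
    by (simp add: has_bochner_integral_iff)
  then show ?thesis
    unfolding has_bochner_integral_integral_eq[OF I] by (simp add: mult.assoc)
qed

text \<open>From order one on the kernel is no longer singular: it is at most
  \<open>T powr (a - 1) / Gamma a\<close> where it meets the support of g.\<close>

lemma integrable_rl_kernel:
  assumes "1 \<le> a" "integrable M g" "\<And>x. x \<in> space M \<Longrightarrow> x \<notin> {0<..<T} \<Longrightarrow> g x = 0" "t \<le> T"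
    and m: "(\<lambda>r. rl_kernel a (t - r)) \<in> borel_measurable M"
  shows "integrable M (\<lambda>r. rl_kernel a (t - r) * g r)"
proof (rule Bochner_Integration.integrable_bound)
  show "integrable M (\<lambda>r. T powr (a - 1) / Gamma a * g r)"
    using assms by simp
  show "(\<lambda>r. rl_kernel a (t - r) * g r) \<in> borel_measurable M"
    using m borel_measurable_integrable[OF assms(2)] by (rule borel_measurable_times)
  have "norm (rl_kernel a (t - r) * g r) \<le> norm (T powr (a - 1) / Gamma a * g r)" if "r \<in> space M" for r
  proof (cases "r \<in> {0<..<T} \<and> r < t")
    case True
    then have "(t - r) powr (a - 1) \<le> T powr (a - 1)"
      using assms by (intro powr_mono2) auto
    then show ?thesis
      using True Gamma_real_pos[of a] assms
      by (auto simp: rl_kernel_def abs_mult intro!: divide_right_mono mult_right_mono)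
  qed (use assms(3) that in \<open>auto simp: rl_kernel_def\<close>)
  then show "AE r in M. norm (rl_kernel a (t - r) * g r) \<le> norm (T powr (a - 1) / Gamma a * g r)"
    by (rule AE_I2)
qed

section \<open>Riemann-Liouville integrals of functions on bounded intervals\<close>

definition rl_integral :: "real \<Rightarrow> (real \<Rightarrow> real) \<Rightarrow> real \<Rightarrow> real" where
  "rl_integral a f t = (LINT s|lebesgue_on {0<..<t}. rl_kernel a (t - s) * f s)"

text \<open>The functions in question are only Lebesgue measurable, whereas Fubini is applied to
  Borel functions on \<open>lborel\<close>. Changing f on a null set and cutting it off outside (0,
  T) alters none of the fractional integrals up to time T.\<close>

lemma borel_representative:
  fixes f :: "real \<Rightarrow> real"
  assumes f: "integrable (lebesgue_on {0<..<T}) f"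
  obtains g where "integrable lborel g" "\<And>x. x \<notin> {0<..<T} \<Longrightarrow> g x = 0"
    "AE x in lebesgue_on {0<..<T}. f x = g x"
    "\<And>a t. t \<le> T \<Longrightarrow> rl_integral a f t = (LINT r|lborel. rl_kernel a (t - r) * g r)"
proof -
  let ?F = "\<lambda>x. indicator {0<..<T} x *\<^sub>R f x"
  have F: "integrable lebesgue ?F"
    using f by (subst (asm) integrable_restrict_space) auto
  then obtain h where h [measurable]: "h \<in> borel_measurable lborel" and hF: "AE x in lborel. ?F x = h x"
    using completion_ex_borel_measurable_real[of ?F lborel] by blast
  define g where "g = (\<lambda>x. indicator {0<..<T} x * h x)"
  have g [measurable]: "g \<in> borel_measurable borel"
    unfolding g_def using h by measurable
  have g0: "g x = 0" if "x \<notin> {0<..<T}" for x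
    using that by (simp add: g_def)
  have gF: "AE x in lebesgue. ?F x = g x"
    using AE_completion[OF hF] by eventually_elim (metis g_def indicator_eq_0_iff indicator_eq_1_iff mult_1 mult_eq_0_iff real_scaleR_def)
  have "integrable lebesgue g"
    using F gF borel_measurable_integrable[OF F] g
    by (subst integrable_cong_AE[of _ _ ?F]) (auto simp: measurable_completion)
  then have gi: "integrable lborel g"
    by (subst (asm) integrable_completion) auto
  have ae: "AE x in lebesgue_on {0<..<T}. f x = g x"
    using gF by (auto simp: AE_restrict_space_iff indicator_def elim: eventually_mono)
  have "rl_integral a f t = (LINT r|lborel. rl_kernel a (t - r) * g r)" if "t \<le> T" for a t
  proof -
    have fm: "f \<in> borel_measurable (lebesgue_on {0<..<t})"
      using that by (intro measurable_restrict_mono[OF borel_measurable_integrable[OF f]]) auto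
    have "rl_integral a f t = (LINT r|lebesgue_on {0<..<t}. rl_kernel a (t - r) * g r)"
      unfolding rl_integral_def
    proof (rule integral_cong_AE)
      have m: "(\<lambda>r. rl_kernel a (t - r)) \<in> borel_measurable (lebesgue_on {0<..<t})"
        by (intro measurable_restrict_space1 measurable_completion) measurable
      have "g \<in> borel_measurable (lebesgue_on {0<..<t})"
        by (intro measurable_restrict_space1 measurable_completion) measurable
      then show "(\<lambda>r. rl_kernel a (t - r) * g r) \<in> borel_measurable (lebesgue_on {0<..<t})"
        by (intro borel_measurable_times m)
      show "(\<lambda>r. rl_kernel a (t - r) * f r) \<in> borel_measurable (lebesgue_on {0<..<t})"
        by (intro borel_measurable_times m fm)
      show "AE r in lebesgue_on {0<..<t}. rl_kernel a (t - r) * f r = rl_kernel a (t - r) * g r"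
        using gF that by (auto simp: AE_restrict_space_iff indicator_def elim: eventually_mono)
    qed
    also have "\<dots> = (LINT r|lebesgue. indicator {0<..<t} r *\<^sub>R (rl_kernel a (t - r) * g r))"
      by (rule integral_restrict_space) simp
    also have "\<dots> = (LINT r|lebesgue. rl_kernel a (t - r) * g r)"
      using that by (intro Bochner_Integration.integral_cong) (auto simp: g_def rl_kernel_def indicator_def)
    also have "\<dots> = (LINT r|lborel. rl_kernel a (t - r) * g r)"
      by (rule integral_completion) measurable
    finally show ?thesis .
  qed
  with gi g0 ae show ?thesis by (rule that)
qed

lemma rl_kernel_1: "rl_kernel 1 x = indicator {0<..} x"
  by (simp add: rl_kernel_def indicator_def)

text \<open>Integrating once more gives order 1 + a, where the kernel is bounded; Fubini at that
  order yields integrability although the kernel of order a itself may be singular.\<close>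

lemma rl_integral_integrable:
  assumes "0 < a" "integrable (lebesgue_on {0<..<t}) f"
  shows "integrable (lebesgue_on {0<..<t}) (rl_integral a f)"
proof -
  obtain g where g: "integrable lborel g" "\<And>x. x \<notin> {0<..<t} \<Longrightarrow> g x = 0"
    "\<And>a s. s \<le> t \<Longrightarrow> rl_integral a f s = (LINT r|lborel. rl_kernel a (s - r) * g r)"
    using borel_representative[OF assms(2)] by metis
  have [measurable]: "g \<in> borel_measurable borel"
    using g(1) by auto
  let ?h = "\<lambda>s. LINT r|lborel. rl_kernel a (s - r) * g r"
  have "integrable lborel (\<lambda>r. rl_kernel (1 + a) (t - r) * g r)"
    using assms by (intro integrable_rl_kernel[OF _ g(1,2)]) auto
  then have "integrable lborel (\<lambda>s. rl_kernel 1 (t - s) * ?h s)"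
    using rl_kernel_fubini[of 1 a g t] assms by (auto simp: has_bochner_integral_iff)
  then have "integrable lborel (\<lambda>s. indicator {0<..<t} s * (rl_kernel 1 (t - s) * ?h s))"
    by (auto dest: integrable_mult_indicator[rotated, where A = "{0<..<t}"])
  then have "integrable lborel (\<lambda>s. indicator {0<..<t} s * ?h s)"
    by (rule Bochner_Integration.integrable_cong[THEN iffD1, rotated 2])
       (auto simp: rl_kernel_1 indicator_def)
  then have "integrable lebesgue (\<lambda>s. indicator {0<..<t} s *\<^sub>R ?h s)"
    by (subst integrable_completion) auto
  then have "integrable (lebesgue_on {0<..<t}) ?h"
    by (subst integrable_restrict_space) auto
  then show ?thesis
    by (rule Bochner_Integration.integrable_cong[THEN iffD2, rotated 2])
       (use g(3) in auto)
qed

text \<open>The condition on a + b makes the composed kernel bounded, so the identity holds at the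
  given point t and not only for almost every t.\<close>

lemma rl_integral_semigroup:
  assumes a: "0 < a" and b: "0 < b" and "1 \<le> a + b" and f: "integrable (lebesgue_on {0<..<t}) f"
  shows "rl_integral a (rl_integral b f) t = rl_integral (a + b) f t"
proof -
  obtain g where g: "integrable lborel g" "\<And>x. x \<notin> {0<..<t} \<Longrightarrow> g x = 0"
    "\<And>a s. s \<le> t \<Longrightarrow> rl_integral a f s = (LINT r|lborel. rl_kernel a (s - r) * g r)"
    using borel_representative[OF assms(4)] by metis
  have [measurable]: "g \<in> borel_measurable borel"
    using g(1) by auto
  let ?h = "\<lambda>s. LINT r|lborel. rl_kernel b (s - r) * g r"
  have "rl_integral a (rl_integral b f) t = (LINT s|lebesgue_on {0<..<t}. rl_kernel a (t - s) * ?h s)"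
    unfolding rl_integral_def[of a] by (intro Bochner_Integration.integral_cong) (auto simp: g(3))
  also have "\<dots> = (LINT s|lebesgue. indicator {0<..<t} s *\<^sub>R (rl_kernel a (t - s) * ?h s))"
    by (rule integral_restrict_space) simp
  also have "\<dots> = (LINT s|lebesgue. rl_kernel a (t - s) * ?h s)"
  proof (intro Bochner_Integration.integral_cong refl)
    fix s
    have "?h s = 0" if "s \<le> 0"
    proof -
      have "rl_kernel b (s - r) * g r = 0" for r
        using g(2)[of r] that by (cases "0 < r") (auto simp: rl_kernel_def)
      then show ?thesis by (intro integral_eq_zero_AE) (rule AE_I2)
    qed
    then show "indicator {0<..<t} s *\<^sub>R (rl_kernel a (t - s) * ?h s) = rl_kernel a (t - s) * ?h s"
      by (cases "s \<le> 0") (auto simp: indicator_def rl_kernel_def)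
  qed
  also have "\<dots> = (LINT s|lborel. rl_kernel a (t - s) * ?h s)"
    by (rule integral_completion) measurable
  also have "\<dots> = (LINT r|lborel. rl_kernel (a + b) (t - r) * g r)"
    using rl_kernel_fubini[OF a b, of g t] integrable_rl_kernel[OF assms(3) g(1,2)]
    by (auto simp: has_bochner_integral_iff)
  finally show ?thesis using g(3) by simp
qed

section \<open>Linearity and congruence rules\<close>

lemma rl_kernel_measurable_lebesgue_on:
  "(\<lambda>r. rl_kernel a (t - r)) \<in> borel_measurable (lebesgue_on S)"
  by (intro measurable_restrict_space1 measurable_completion) measurable

lemma integrable_rl_kernel_lebesgue_on:
  "1 \<le> a \<Longrightarrow> integrable (lebesgue_on {0<..<t}) f \<Longrightarrow>
    integrable (lebesgue_on {0<..<t}) (\<lambda>s. rl_kernel a (t - s) * f s)"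
  by (rule integrable_rl_kernel[where T = t]) (auto simp: rl_kernel_measurable_lebesgue_on)

lemma integrable_lebesgue_on_subset:
  fixes f :: "'a::euclidean_space \<Rightarrow> 'b::{banach, second_countable_topology}"
  assumes "integrable (lebesgue_on A) f" "A \<in> sets lebesgue" "B \<in> sets lebesgue" "B \<subseteq> A"
  shows "integrable (lebesgue_on B) f"
proof -
  have "set_integrable lebesgue A f"
    using assms by (simp add: integrable_restrict_space set_integrable_def)
  then have "set_integrable lebesgue B f"
    by (rule set_integrable_subset) (use assms in auto)
  then show ?thesis
    using assms by (simp add: integrable_restrict_space set_integrable_def)
qed

lemma rl_integral_cong:
  "(\<And>s. 0 < s \<Longrightarrow> s < t \<Longrightarrow> f s = g s) \<Longrightarrow> rl_integral a f t = rl_integral a g t"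
  unfolding rl_integral_def by (intro Bochner_Integration.integral_cong) auto

lemma rl_integral_cmult: "rl_integral a (\<lambda>s. c * f s) t = c * rl_integral a f t"
  unfolding rl_integral_def by (simp add: mult.left_commute)

lemma rl_integral_zero: "rl_integral a (\<lambda>s. 0) t = 0"
  unfolding rl_integral_def by simp

lemma rl_integral_add:
  "1 \<le> a \<Longrightarrow> integrable (lebesgue_on {0<..<t}) f \<Longrightarrow> integrable (lebesgue_on {0<..<t}) g \<Longrightarrow>
    rl_integral a (\<lambda>s. f s + g s) t = rl_integral a f t + rl_integral a g t"
  unfolding rl_integral_def
  by (simp add: distrib_left Bochner_Integration.integral_add integrable_rl_kernel_lebesgue_on)

lemma rl_integral_sum:
  "1 \<le> a \<Longrightarrow> (\<And>i. i \<in> I \<Longrightarrow> integrable (lebesgue_on {0<..<t}) (f i)) \<Longrightarrow>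
    rl_integral a (\<lambda>s. \<Sum>i\<in>I. f i s) t = (\<Sum>i\<in>I. rl_integral a (f i) t)"
  unfolding rl_integral_def
  by (simp add: sum_distrib_left Bochner_Integration.integral_sum integrable_rl_kernel_lebesgue_on)

lemma rl_integral_cong_AE:
  assumes "f \<in> borel_measurable (lebesgue_on {0<..<t})" "g \<in> borel_measurable (lebesgue_on {0<..<t})"
    and "AE s in lebesgue_on {0<..<t}. f s = g s"
  shows "rl_integral a f t = rl_integral a g t"
  unfolding rl_integral_def using assms
  by (intro integral_cong_AE borel_measurable_times rl_kernel_measurable_lebesgue_on)
     (auto elim: eventually_mono)

section \<open>The integral of order one as an indefinite integral\<close>

lemma integral_lebesgue_on_Ioo:
  fixes f :: "real \<Rightarrow> real"
  assumes "integrable (lebesgue_on {0<..<t}) f" "0 \<le> r" "s \<le> t"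
  shows "(LINT x|lebesgue_on {r<..<s}. f x) = integral {r..s} f"
proof -
  have "integrable (lebesgue_on {r<..<s}) f"
    using assms by (intro integrable_lebesgue_on_subset[OF assms(1)]) auto
  then have "(LINT x|lebesgue_on {r<..<s}. f x) = integral {r<..<s} f"
    by (intro lebesgue_integral_eq_integral) auto
  then show ?thesis
    by (simp add: integral_open_interval_real)
qed

lemma integrable_on_Icc:
  fixes f :: "real \<Rightarrow> real"
  assumes "integrable (lebesgue_on {0<..<t}) f"
  shows "f integrable_on {0..t}"
  using integrable_on_lebesgue_on[OF assms] by (simp add: integrable_on_Icc_iff_Ioo)

lemma rl_integral_1:
  assumes "integrable (lebesgue_on {0<..<t}) f" "s \<le> t"
  shows "rl_integral 1 f s = integral {0..s} f"
proof -
  have "rl_integral 1 f s = (LINT x|lebesgue_on {0<..<s}. f x)"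
    unfolding rl_integral_def by (intro Bochner_Integration.integral_cong) (auto simp: rl_kernel_1)
  then show ?thesis
    using assms by (simp add: integral_lebesgue_on_Ioo)
qed

lemma continuous_on_rl_integral_1_Icc:
  assumes "integrable (lebesgue_on {0<..<t}) f"
  shows "continuous_on {0..t} (rl_integral 1 f)"
proof -
  have "continuous_on {0..t} (\<lambda>x. integral {0..x} f)"
    by (intro indefinite_integral_continuous_1 integrable_on_Icc assms)
  then show ?thesis
    by (rule continuous_on_eq) (simp add: rl_integral_1[OF assms])
qed

lemma continuous_on_rl_integral_1:
  assumes "\<And>t. 0 < t \<Longrightarrow> t < T \<Longrightarrow> integrable (lebesgue_on {0<..<t}) f"
  shows "continuous_on {0<..<T} (rl_integral 1 f)"
proof -
  have "isCont (rl_integral 1 f) s" if s: "0 < s" "s < T" for s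
  proof -
    \<comment> \<open>Integrability is available only up to times below T, so s is placed inside a
      slightly larger interval.\<close>
    obtain t where t: "s < t" "t < T" using dense s by blast
    with s assms have "continuous_on {0..t} (rl_integral 1 f)"
      by (intro continuous_on_rl_integral_1_Icc) simp
    then show ?thesis
      using s t by (intro continuous_on_interior[of "{0..t}"]) auto
  qed
  then show ?thesis
    by (simp add: continuous_at_imp_continuous_on)
qed

text \<open>A continuous function is the derivative of its indefinite integral, here the zero
  function.\<close>

lemma rl_integral_1_eq_0_imp:
  assumes f: "continuous_on {0<..<T} f"
    and "\<And>t. 0 < t \<Longrightarrow> t < T \<Longrightarrow> integrable (lebesgue_on {0<..<t}) f"
    and 0: "\<And>t. 0 < t \<Longrightarrow> t < T \<Longrightarrow> rl_integral 1 f t = 0" and s: "0 < s" "s < T"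
  shows "f s = 0"
proof -
  obtain t where t: "s < t" "t < T" using dense s by blast
  with s assms have i: "integrable (lebesgue_on {0<..<t}) f" by simp
  have "((\<lambda>x. integral {0..x} f) has_vector_derivative f s) (at s within {0..t} - {})"
  proof (rule integral_has_vector_derivative_continuous_at)
    show "f integrable_on {0..t}" by (rule integrable_on_Icc[OF i])
    show "continuous (at s within {0..t} - {}) f"
      using f s continuous_on_interior[of "{0<..<T}" f s] by (auto intro: continuous_at_imp_continuous_at_within)
  qed (use s t in auto)
  then have "((\<lambda>x. integral {0..x} f) has_vector_derivative f s) (at s within {0<..<t})"
    by (rule has_vector_derivative_within_subset) auto
  moreover have "integral {0..x} f = 0" if "x \<in> {0<..<t}" for x
    using 0[of x] rl_integral_1[OF i, of x] that t by simp
  ultimately have "((\<lambda>x. 0) has_vector_derivative f s) (at s within {0<..<t})"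
    using s t by (intro has_vector_derivative_transform[of s "{0<..<t}" "\<lambda>x. 0" "\<lambda>x. integral {0..x} f" "f s"]) simp_all
  then have "((\<lambda>x. 0) has_vector_derivative f s) (at s)"
    using s t at_within_open[of s "{0<..<t}"] by auto
  then show ?thesis
    by (rule vector_derivative_unique_at) (rule has_vector_derivative_const)
qed

section \<open>Caputo derivatives\<close>

lemma time_regular_integrable:
  assumes "time_regular n T w" "k < n" "t \<in> {0<..<T}"
  shows "integrable (lebesgue_on {0<..<t}) ((deriv ^^ Suc k) w)"
  using assms unfolding time_regular_def by blast

text \<open>The fundamental theorem of calculus for absolutely continuous functions, with starting
  value 0 at time 0.\<close>

lemma rl_integral_1_deriv:
  assumes reg: "time_regular n T w" and van: "vanishing_initial_data n w" and k: "k < n"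
    and t: "t \<in> {0<..<T}"
  shows "rl_integral 1 ((deriv ^^ Suc k) w) t = (deriv ^^ k) w t"
proof -
  let ?f = "(deriv ^^ Suc k) w" and ?g = "(deriv ^^ k) w"
  let ?I = "\<lambda>s. integral {0..s} ?f"
  have i: "integrable (lebesgue_on {0<..<t}) ?f"
    by (rule time_regular_integrable[OF reg k t])
  have on: "?f integrable_on {0..t}"
    by (rule integrable_on_Icc[OF i])
  have "?g t - ?g r = ?I t - ?I r" if r: "r \<in> {0<..<t}" for r
  proof -
    have "?g t - ?g r = (LINT s|lebesgue_on {r<..<t}. ?f s)"
      using reg k t r unfolding time_regular_def by blast
    also have "\<dots> = integral {r..t} ?f"
      using r by (intro integral_lebesgue_on_Ioo[OF i]) auto
    finally show ?thesis
      using Henstock_Kurzweil_Integration.integral_combine[OF _ _ on, of r] r by auto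
  qed
  \<comment> \<open>\<open>time_regular\<close> compares two positive times only; the initial value
    enters by letting r tend to 0 from the right.\<close>
  then have "eventually (\<lambda>r. ?g t - ?I t + ?I r = ?g r) (at_right 0)"
    using t by (intro eventually_at_rightI[of 0 t]) (auto simp: algebra_simps)
  moreover have "(?g \<longlongrightarrow> 0) (at_right 0)"
    using van k unfolding vanishing_initial_data_def by blast
  ultimately have "((\<lambda>r. ?g t - ?I t + ?I r) \<longlongrightarrow> 0) (at_right 0)"
    by (simp add: tendsto_cong)
  moreover have "continuous_on {0..t} ?I"
    by (intro indefinite_integral_continuous_1 on)
  from this[unfolded continuous_on_def, rule_format, of 0]
  have "(?I \<longlongrightarrow> 0) (at_right 0)"
    using t by (simp add: at_within_Icc_at_right)
  then have "((\<lambda>r. ?g t - ?I t + ?I r) \<longlongrightarrow> ?g t - ?I t + 0) (at_right 0)"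
    by (intro tendsto_intros)
  ultimately have "?g t - ?I t + 0 = 0"
    by (intro tendsto_unique[of "at_right (0::real)"]) auto
  then show ?thesis
    using rl_integral_1[OF i] by simp
qed

lemma rl_integral_deriv:
  assumes reg: "time_regular n T w" and van: "vanishing_initial_data n w"
  shows "Suc k \<le> n \<Longrightarrow> t \<in> {0<..<T} \<Longrightarrow> rl_integral (real (Suc k)) ((deriv ^^ Suc k) w) t = w t"
proof (induction k arbitrary: t)
  case 0
  then show ?case using rl_integral_1_deriv[OF reg van, of 0 t] by simp
next
  case (Suc k)
  have "rl_integral (real (Suc k) + 1) ((deriv ^^ Suc (Suc k)) w) t =
      rl_integral (real (Suc k)) (rl_integral 1 ((deriv ^^ Suc (Suc k)) w)) t"
    using Suc.prems by (intro rl_integral_semigroup[symmetric] time_regular_integrable[OF reg]) auto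
  also have "\<dots> = rl_integral (real (Suc k)) ((deriv ^^ Suc k) w) t"
    using Suc.prems by (intro rl_integral_cong rl_integral_1_deriv[OF reg van]) auto
  also have "\<dots> = w t"
    using Suc by auto
  finally show ?case by (simp add: add.commute)
qed

lemma caputo_eq_rl_integral:
  assumes "real (nat \<lceil>\<mu>\<rceil>) \<noteq> \<mu>"
  shows "caputo \<mu> w t = rl_integral (real (nat \<lceil>\<mu>\<rceil>) - \<mu>) ((deriv ^^ nat \<lceil>\<mu>\<rceil>) w) t"
proof -
  have "rl_integral (real (nat \<lceil>\<mu>\<rceil>) - \<mu>) ((deriv ^^ nat \<lceil>\<mu>\<rceil>) w) t =
    (LINT s|lebesgue_on {0<..<t}. 1 / Gamma (real (nat \<lceil>\<mu>\<rceil>) - \<mu>) *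
      ((t - s) powr (real (nat \<lceil>\<mu>\<rceil>) - \<mu> - 1) * (deriv ^^ nat \<lceil>\<mu>\<rceil>) w s))"
    unfolding rl_integral_def by (intro Bochner_Integration.integral_cong) (auto simp: rl_kernel_def)
  then show ?thesis
    using assms by (simp add: caputo_def Let_def del: of_nat_nat)
qed

text \<open>With m the order \<mu> rounded up, vanishing initial data make w the m-fold integral of
  its m-th derivative. Both sides of the identity are thus the integral of order M - \<mu> + m of
  that derivative, by the semigroup law.\<close>

lemma rl_integral_caputo:
  assumes reg: "time_regular n T w" and van: "vanishing_initial_data n w"
    and \<mu>: "0 < \<mu>" "\<mu> \<le> real n" and t: "t \<in> {0<..<T}"
  shows "integrable (lebesgue_on {0<..<t}) (caputo \<mu> w)"
    and "1 \<le> M \<Longrightarrow> \<mu> < M \<Longrightarrow> rl_integral M (caputo \<mu> w) t = rl_integral (M - \<mu>) w t"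
proof -
  define m where "m = nat \<lceil>\<mu>\<rceil>"
  have m: "\<mu> \<le> real m" "1 \<le> m" "m \<le> n"
    using \<mu> unfolding m_def by linarith+
  let ?f = "(deriv ^^ m) w"
  have f: "integrable (lebesgue_on {0<..<s}) ?f" if "s \<in> {0<..<T}" for s
    using time_regular_integrable[OF reg, of "m - 1" s] m that by simp
  have I: "rl_integral (real m) ?f s = w s" if "s \<in> {0<..<T}" for s
    using rl_integral_deriv[OF reg van, of "m - 1" s] m that by simp
  have II: "rl_integral (M - \<mu> + real m) ?f t = rl_integral (M - \<mu>) w t" if "\<mu> < M" for M
  proof -
    have "rl_integral (M - \<mu>) w t = rl_integral (M - \<mu>) (rl_integral (real m) ?f) t"
      using t by (intro rl_integral_cong) (auto simp: I)
    also have "\<dots> = rl_integral (M - \<mu> + real m) ?f t"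
      using that m t by (intro rl_integral_semigroup f) auto
    finally show ?thesis by simp
  qed
  have "integrable (lebesgue_on {0<..<t}) (caputo \<mu> w) \<and>
    (1 \<le> M \<longrightarrow> \<mu> < M \<longrightarrow> rl_integral M (caputo \<mu> w) t = rl_integral (M - \<mu>) w t)" for M
  proof (cases "real m = \<mu>")
    \<comment> \<open>For integer order \<open>caputo\<close> is the plain derivative by definition,
      not an integral of order 0.\<close>
    case True
    then have "caputo \<mu> w = ?f"
      by (simp add: caputo_def m_def Let_def fun_eq_iff del: of_nat_nat)
    then show ?thesis
      using f[OF t] II[of M] True by (metis diff_add_cancel)
  next
    case False
    then have c: "caputo \<mu> w = rl_integral (real m - \<mu>) ?f"
      using caputo_eq_rl_integral[of \<mu> w] by (auto simp: m_def simp del: of_nat_nat)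
    have "rl_integral M (rl_integral (real m - \<mu>) ?f) t = rl_integral (M + (real m - \<mu>)) ?f t" if "1 \<le> M"
      using False m that by (intro rl_integral_semigroup f t) auto
    moreover have "M + (real m - \<mu>) = M - \<mu> + real m"
      by simp
    moreover have "integrable (lebesgue_on {0<..<t}) (rl_integral (real m - \<mu>) ?f)"
      using False m by (intro rl_integral_integrable f t) auto
    ultimately show ?thesis
      unfolding c using II[of M] by metis
  qed
  then show "integrable (lebesgue_on {0<..<t}) (caputo \<mu> w)"
    and "1 \<le> M \<Longrightarrow> \<mu> < M \<Longrightarrow> rl_integral M (caputo \<mu> w) t = rl_integral (M - \<mu>) w t"
    by blast+
qed


section \<open>Volterra equations\<close>

text \<open>In the norm weighted by \<open>exp (- l * s)\<close>, the operator norm of the integral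
  of order a is at most the Laplace transform of its kernel at l.\<close>

lemma rl_integral_exp_bound:
  assumes a: "0 < a" and l: "0 < l" and f: "\<And>s. 0 < s \<Longrightarrow> s < t \<Longrightarrow> \<bar>f s\<bar> \<le> S * exp (l * s)" and S: "0 \<le> S"
  shows "\<bar>rl_integral a f t\<bar> \<le> S * l powr - a * exp (l * t)"
proof -
  let ?e = "\<lambda>x. rl_kernel a x * exp (- l * x)"
  let ?h = "\<lambda>s. S * exp (l * t) * ?e (t - s)"
  have "has_bochner_integral lborel (\<lambda>s. ?e (t + (- 1) * s)) (l powr - a /\<^sub>R \<bar>- 1\<bar>)"
    using lborel_has_bochner_integral_real_affine_iff[of "- 1" ?e "l powr - a" t] rl_kernel_laplace[OF a l]
    by simp
  then have "has_bochner_integral lborel ?h (S * exp (l * t) * l powr - a)"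
    by (intro has_bochner_integral_mult_right) simp
  then have int: "integrable lebesgue ?h" and eq: "(LINT s|lebesgue. ?h s) = S * exp (l * t) * l powr - a"
    by (auto simp: has_bochner_integral_iff integrable_completion integral_completion)
  have nonneg: "0 \<le> ?h s" for s
    using S by (simp add: rl_kernel_nonneg[OF a])
  have "\<bar>rl_integral a f t\<bar> \<le> (LINT s|lebesgue_on {0<..<t}. norm (rl_kernel a (t - s) * f s))"
    using integral_norm_bound[of "lebesgue_on {0<..<t}" "\<lambda>s. rl_kernel a (t - s) * f s"]
    by (simp add: rl_integral_def)
  also have "\<dots> = (LINT s|lebesgue. indicator {0<..<t} s *\<^sub>R norm (rl_kernel a (t - s) * f s))"
    by (rule integral_restrict_space) simp
  \<comment> \<open>No measurability of f enters: an integrand that is not integrable has integral 0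
    by convention, and \<open>?h\<close> is nonnegative.\<close>
  also have "\<dots> \<le> (LINT s|lebesgue. ?h s)"
  proof (rule integral_mono'[OF int _ nonneg])
    fix s
    show "indicator {0<..<t} s *\<^sub>R norm (rl_kernel a (t - s) * f s) \<le> ?h s"
    proof (cases "s \<in> {0<..<t}")
      case True
      have "norm (rl_kernel a (t - s) * f s) \<le> rl_kernel a (t - s) * (S * exp (l * s))"
        using True f rl_kernel_nonneg[OF a] by (auto simp: abs_mult intro!: mult_left_mono)
      also have "\<dots> = ?h s"
        by (simp add: algebra_simps flip: exp_add)
      finally show ?thesis using True by simp
    qed (use nonneg in simp)
  qed
  finally show ?thesis
    unfolding eq by (simp add: mult_ac)
qed

text \<open>For l large enough the weighted norms of the operators on the right add up to less than
  1/2. Each insertion of the equation into itself then halves the bound on W.\<close>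

lemma rl_volterra_zero:
  assumes I: "finite I" "\<And>i. i \<in> I \<Longrightarrow> 0 < \<delta> i"
    and C: "\<And>t. 0 < t \<Longrightarrow> t < T \<Longrightarrow> \<bar>W t\<bar> \<le> C"
    and eq: "\<And>t. 0 < t \<Longrightarrow> t < T \<Longrightarrow> W t = (\<Sum>i\<in>I. e i * rl_integral (\<delta> i) W t)"
    and t: "0 < t" "t < T"
  shows "W t = 0"
proof -
  have "((\<lambda>l. \<Sum>i\<in>I. \<bar>e i\<bar> * l powr - \<delta> i) \<longlongrightarrow> (\<Sum>i\<in>I. \<bar>e i\<bar> * 0)) at_top"
    using I by (intro tendsto_intros tendsto_neg_powr filterlim_ident) auto
  then have "eventually (\<lambda>l. (\<Sum>i\<in>I. \<bar>e i\<bar> * l powr - \<delta> i) < 1/2) at_top"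
    by (intro order_tendstoD) auto
  then have "eventually (\<lambda>l. 0 < l \<and> (\<Sum>i\<in>I. \<bar>e i\<bar> * l powr - \<delta> i) < 1/2) at_top"
    by (intro eventually_conj eventually_gt_at_top)
  then obtain l where l: "0 < l" "(\<Sum>i\<in>I. \<bar>e i\<bar> * l powr - \<delta> i) < 1/2"
    by (auto dest: eventually_happens simp: trivial_limit_at_top_linorder)
  have C0: "0 \<le> C" using C[OF t] by linarith
  have bound: "\<bar>W s\<bar> \<le> C * (1/2) ^ n * exp (l * s)" if "0 < s" "s < T" for n s
    using that
  proof (induction n arbitrary: s)
    case 0
    then show ?case
      using C[OF 0] C0 mult_left_mono[of 1 "exp (l * s)" C] l(1) by simp
  next
    case (Suc n)
    let ?S = "C * (1/2) ^ n"
    have "\<bar>W s\<bar> \<le> (\<Sum>i\<in>I. \<bar>e i\<bar> * \<bar>rl_integral (\<delta> i) W s\<bar>)"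
      unfolding eq[OF Suc.prems] by (rule order_trans[OF sum_abs]) (simp add: abs_mult)
    also have "\<dots> \<le> (\<Sum>i\<in>I. \<bar>e i\<bar> * (?S * l powr - \<delta> i * exp (l * s)))"
      using Suc C0 l I by (intro sum_mono mult_left_mono rl_integral_exp_bound) auto
    also have "\<dots> = ?S * exp (l * s) * (\<Sum>i\<in>I. \<bar>e i\<bar> * l powr - \<delta> i)"
      by (simp add: sum_distrib_left mult_ac)
    also have "\<dots> \<le> ?S * exp (l * s) * (1/2)"
      using l C0 by (intro mult_left_mono) auto
    finally show ?case by simp
  qed
  have "(\<lambda>n. C * (1/2) ^ n * exp (l * t)) \<longlonglongrightarrow> C * 0 * exp (l * t)"
    by (intro tendsto_intros LIMSEQ_power_zero) auto
  then have "\<bar>W t\<bar> \<le> C * 0 * exp (l * t)"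
    by (rule LIMSEQ_le_const) (use bound[OF t] in blast)
  then show ?thesis by simp
qed

text \<open>Orders are peeled off one at a time. The integral of order one of f is continuous, so
  the induction hypothesis applies to it and leaves the case of order one.\<close>

lemma rl_integral_Suc_eq_0_imp:
  assumes "continuous_on {0<..<T} f"
    and "\<And>t. 0 < t \<Longrightarrow> t < T \<Longrightarrow> integrable (lebesgue_on {0<..<t}) f"
    and "\<And>t. 0 < t \<Longrightarrow> t < T \<Longrightarrow> rl_integral (real (Suc m)) f t = 0" and s: "0 < s" "s < T"
  shows "f s = 0"
  using assms
proof (induction m arbitrary: f s)
  case 0
  then show ?case by (intro rl_integral_1_eq_0_imp[of T f s]) auto
next
  case (Suc m)
  have "rl_integral 1 f t = 0" if t: "0 < t" "t < T" for t
  proof (rule Suc.IH[OF _ _ _ t])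
    show "continuous_on {0<..<T} (rl_integral 1 f)"
      by (rule continuous_on_rl_integral_1[OF Suc.prems(2)])
    show "integrable (lebesgue_on {0<..<t}) (rl_integral 1 f)" if "0 < t" "t < T" for t
      by (intro rl_integral_integrable Suc.prems that) simp
    show "rl_integral (real (Suc m)) (rl_integral 1 f) t = 0" if "0 < t" "t < T" for t
      using rl_integral_semigroup[OF _ _ _ Suc.prems(2), of "real (Suc m)" 1 t] Suc.prems(3) that
      by (simp add: add.commute)
  qed
  then show ?case
    using Suc.prems by (intro rl_integral_1_eq_0_imp[of T f s]) auto
qed

text \<open>
  With \<open>M\<close> the largest order having a nonzero coefficient, integrating the relation \<open>M + 1\<close>
  times turns it into a Volterra equation of the second kind for the integral of order 5 of \<open>w\<close>.
\<close>

lemma rl_integral_independent: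
  assumes S: "finite S" "S \<subseteq> {0..3}" and \<mu>: "\<mu> \<in> S" "E \<mu> \<noteq> 0"
    and w: "continuous_on {0<..<T} w"
    and int: "\<And>t. 0 < t \<Longrightarrow> t < T \<Longrightarrow> integrable (lebesgue_on {0<..<t}) w"
    and eq: "\<And>t. 0 < t \<Longrightarrow> t < T \<Longrightarrow> (\<Sum>\<mu>\<in>S. E \<mu> * rl_integral (4 - \<mu>) w t) = 0"
    and t: "0 < t" "t < T"
  shows "w t = 0"
proof -
  \<comment> \<open>Orders with zero coefficient are discarded so that the coefficient at the
    maximum M can be divided by.\<close>
  define S' where "S' = {\<mu>\<in>S. E \<mu> \<noteq> 0}"
  define M where "M = Max S'"
  define W where "W = rl_integral 5 w"
  have S': "finite S'" "S' \<subseteq> {0..3}" "S' \<noteq> {}"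
    using S \<mu> by (auto simp: S'_def)
  have le: "\<nu> \<le> M" if "\<nu> \<in> S'" for \<nu>
    unfolding M_def using S' that by auto
  have M: "M \<in> S'"
    unfolding M_def using S' by (intro Max_in)
  then have E: "E M \<noteq> 0" "0 \<le> M" "M \<le> 3"
    using S' by (auto simp: S'_def)
  \<comment> \<open>The orders add up to M + 1 + 4 - \<nu> = 5 + (M - \<nu>). The outer order is M +
    1 because M may be 0, while splitting the sum requires an order of at least one.\<close>
  have W5: "rl_integral (M + 1) (rl_integral (4 - \<nu>) w) t =
      (if \<nu> = M then W t else rl_integral (M - \<nu>) W t)" if "0 < t" "t < T" "\<nu> \<in> S'" for t \<nu>
  proof -
    have "\<nu> \<in> {0..3}" using that S' by blast
    then have "rl_integral (M + 1) (rl_integral (4 - \<nu>) w) t = rl_integral (M + 1 + (4 - \<nu>)) w t"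
      using E that by (intro rl_integral_semigroup int) auto
    also have "\<dots> = rl_integral (M - \<nu> + 5) w t"
      by (simp add: algebra_simps)
    also have "\<dots> = (if \<nu> = M then W t else rl_integral (M - \<nu>) W t)"
      unfolding W_def using le[OF that(3)] that by (auto intro!: rl_integral_semigroup[symmetric] int)
    finally show ?thesis .
  qed
  have eqW: "W t = (\<Sum>\<nu>\<in>S' - {M}. (- E \<nu> / E M) * rl_integral (M - \<nu>) W t)" if t: "0 < t" "t < T" for t
  proof -
    have "rl_integral (M + 1) (\<lambda>s. \<Sum>\<nu>\<in>S'. E \<nu> * rl_integral (4 - \<nu>) w s) t = rl_integral (M + 1) (\<lambda>s. 0) t"
    proof (rule rl_integral_cong)
      fix s assume "0 < s" "s < t"
      then have "(\<Sum>\<nu>\<in>S. E \<nu> * rl_integral (4 - \<nu>) w s) = 0"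
        using t by (intro eq) auto
      moreover have "(\<Sum>\<nu>\<in>S'. E \<nu> * rl_integral (4 - \<nu>) w s) = (\<Sum>\<nu>\<in>S. E \<nu> * rl_integral (4 - \<nu>) w s)"
        unfolding S'_def using S by (intro sum.mono_neutral_left) auto
      ultimately show "(\<Sum>\<nu>\<in>S'. E \<nu> * rl_integral (4 - \<nu>) w s) = 0" by simp
    qed
    also have "\<dots> = 0" by (rule rl_integral_zero)
    finally have "0 = (\<Sum>\<nu>\<in>S'. rl_integral (M + 1) (\<lambda>s. E \<nu> * rl_integral (4 - \<nu>) w s) t)"
      using E S' t by (subst (asm) rl_integral_sum) (auto intro!: integrable_mult_right rl_integral_integrable int)
    also have "\<dots> = (\<Sum>\<nu>\<in>S'. E \<nu> * (if \<nu> = M then W t else rl_integral (M - \<nu>) W t))"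
      using W5 t by (intro sum.cong) (auto simp: rl_integral_cmult)
    also have "\<dots> = E M * W t + (\<Sum>\<nu>\<in>S' - {M}. E \<nu> * (if \<nu> = M then W t else rl_integral (M - \<nu>) W t))"
      using S' M by (subst sum.remove[of _ M]) auto
    also have "(\<Sum>\<nu>\<in>S' - {M}. E \<nu> * (if \<nu> = M then W t else rl_integral (M - \<nu>) W t)) =
        (\<Sum>\<nu>\<in>S' - {M}. E \<nu> * rl_integral (M - \<nu>) W t)"
      by (intro sum.cong) auto
    finally have "W t = - (\<Sum>\<nu>\<in>S' - {M}. E \<nu> * rl_integral (M - \<nu>) W t) / E M"
      using E by (simp add: field_simps)
    then show ?thesis
      by (simp add: sum_divide_distrib sum_negf)
  qed
  have W0: "W t = 0" if t: "0 < t" "t < T" for t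
  proof -
    \<comment> \<open>The Volterra lemma needs a bounded W, which is available on (0, \<tau>) for
      \<tau> < T: writing order 5 as 1 + 4 shows continuity on the compact interval
      [0, \<tau>].\<close>
    obtain \<tau> where \<tau>: "t < \<tau>" "\<tau> < T" using dense t by blast
    have i: "integrable (lebesgue_on {0<..<\<tau>}) w"
      using \<tau> t by (intro int) auto
    have "continuous_on {0..\<tau>} (rl_integral 1 (rl_integral 4 w))"
      by (intro continuous_on_rl_integral_1_Icc rl_integral_integrable i) simp
    then have "compact (rl_integral 1 (rl_integral 4 w) ` {0..\<tau>})"
      by (intro compact_continuous_image) auto
    then obtain C where C: "\<forall>s\<in>{0..\<tau>}. \<bar>rl_integral 1 (rl_integral 4 w) s\<bar> \<le> C"
      by (auto dest!: compact_imp_bounded simp: bounded_iff)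
    show ?thesis
    proof (rule rl_volterra_zero[where I = "S' - {M}" and \<delta> = "\<lambda>\<nu>. M - \<nu>"
          and e = "\<lambda>\<nu>. - E \<nu> / E M" and C = C, OF _ _ _ _ t(1) \<tau>(1)])
      show "\<bar>W s\<bar> \<le> C" if "0 < s" "s < \<tau>" for s
        using bspec[OF C, of s] rl_integral_semigroup[of 1 4 s w] int[of s] that \<tau> by (simp add: W_def)
      show "0 < M - \<nu>" if "\<nu> \<in> S' - {M}" for \<nu>
        using le[of \<nu>] that by auto
    qed (use S' eqW \<tau> in auto)
  qed
  \<comment> \<open>Order 5 is \<open>Suc 4\<close>; W = 0 is undone by injectivity of repeated
    integration.\<close>
  show ?thesis
    using W0 by (intro rl_integral_Suc_eq_0_imp[of T w 4, OF w int _ t]) (auto simp: W_def)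
qed


section \<open>Square-integrable functions and the Laplace domain\<close>

lemma integrable_mult_L2:
  assumes "v \<in> L2 M" "w \<in> L2 M"
  shows "integrable M (\<lambda>x. v x \<bullet> w x)"
proof (rule Bochner_Integration.integrable_bound)
  show "integrable M (\<lambda>x. (norm (v x))\<^sup>2 + (norm (w x))\<^sup>2)"
    using assms by (auto simp: L2_def)
  show "(\<lambda>x. v x \<bullet> w x) \<in> borel_measurable M"
    using assms by (auto simp: L2_def intro: borel_measurable_inner)
  have "\<bar>v x \<bullet> w x\<bar> \<le> (norm (v x))\<^sup>2 + (norm (w x))\<^sup>2" for x
  proof -
    have "\<bar>v x \<bullet> w x\<bar> \<le> norm (v x) * norm (w x)"
      by (rule Cauchy_Schwarz_ineq2)
    moreover have "2 * (norm (v x) * norm (w x)) \<le> (norm (v x))\<^sup>2 + (norm (w x))\<^sup>2"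
      using sum_squares_bound[of "norm (v x)" "norm (w x)"] by simp
    moreover have "0 \<le> norm (v x) * norm (w x)" by simp
    ultimately show ?thesis by linarith
  qed
  then show "AE x in M. norm (v x \<bullet> w x) \<le> norm ((norm (v x))\<^sup>2 + (norm (w x))\<^sup>2)"
    by (intro AE_I2) simp
qed

lemma L2_diff_cmult:
  fixes v w :: "'x \<Rightarrow> real"
  assumes "v \<in> L2 M" "w \<in> L2 M"
  shows "(\<lambda>x. v x - r * w x) \<in> L2 M"
proof -
  have "integrable M (\<lambda>x. (v x - r * w x)\<^sup>2)"
  proof (rule Bochner_Integration.integrable_bound)
    show "integrable M (\<lambda>x. 2 * (v x)\<^sup>2 + 2 * r\<^sup>2 * (w x)\<^sup>2)"
      using assms by (auto simp: L2_def)
    show "(\<lambda>x. (v x - r * w x)\<^sup>2) \<in> borel_measurable M"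
      using assms by (auto simp: L2_def)
    have "(v x - r * w x)\<^sup>2 \<le> 2 * (v x)\<^sup>2 + 2 * r\<^sup>2 * (w x)\<^sup>2" for x
      using zero_le_power2[of "v x + r * w x"] by (simp add: power2_eq_square algebra_simps)
    then show "AE x in M. norm ((v x - r * w x)\<^sup>2) \<le> norm (2 * (v x)\<^sup>2 + 2 * r\<^sup>2 * (w x)\<^sup>2)"
      by (intro AE_I2) (simp add: abs_of_nonneg)
  qed
  then show ?thesis
    using assms by (auto simp: L2_def)
qed

lemma L2_cmult:
  fixes w :: "'x \<Rightarrow> real"
  assumes "w \<in> L2 M"
  shows "(\<lambda>x. r * w x) \<in> L2 M"
proof -
  have "w \<in> borel_measurable M" "integrable M (\<lambda>x. (w x)\<^sup>2)"
    using assms by (simp_all add: L2_def)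
  then show ?thesis
    by (simp add: L2_def power_mult_distrib)
qed

lemma inner_L2_cmult_right: "inner_L2 M v (\<lambda>x. r * w x) = r * inner_L2 M v (w :: 'x \<Rightarrow> real)"
  unfolding inner_L2_def by (simp add: mult.left_commute)

lemma inner_L2_diff_cmult_left:
  fixes v w z :: "'x \<Rightarrow> real"
  assumes "v \<in> L2 M" "w \<in> L2 M" "z \<in> L2 M"
  shows "inner_L2 M (\<lambda>x. v x - r * w x) z = inner_L2 M v z - r * inner_L2 M w z"
  using integrable_mult_L2[OF assms(1,3)] integrable_mult_L2[OF assms(2,3)]
  by (simp add: inner_L2_def left_diff_distrib mult.assoc)

text \<open>One point s of absolute convergence suffices: \<sigma> is the Laplace integrand times
  \<open>exp (s * x)\<close>, a factor bounded on bounded intervals.\<close>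

lemma laplace_domain_integrable:
  assumes "laplace_domain \<sigma> \<noteq> {}"
  shows "integrable (lebesgue_on {0<..<t}) \<sigma>"
proof -
  obtain s where "integrable (lebesgue_on {0<..}) (laplace_integrand \<sigma> s)"
    using assms by (auto simp: laplace_domain_def)
  then have i: "integrable (lebesgue_on {0<..<t}) (laplace_integrand \<sigma> s)"
    by (rule integrable_lebesgue_on_subset) auto
  have \<sigma>: "\<sigma> x = Re (exp (s * of_real x) * laplace_integrand \<sigma> s x)" for x
    by (simp add: laplace_integrand_def mult.assoc[symmetric] flip: exp_add)
  have e: "(\<lambda>x. exp (s * of_real x)) \<in> borel_measurable (lebesgue_on {0<..<t})"
    by (intro measurable_restrict_space1 measurable_completion)
       (auto intro!: borel_measurable_continuous_onI continuous_intros)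
  show ?thesis
  proof (rule Bochner_Integration.integrable_bound)
    show "integrable (lebesgue_on {0<..<t}) (\<lambda>x. exp (\<bar>Re s\<bar> * t) * norm (laplace_integrand \<sigma> s x))"
      using i by (intro integrable_mult_right integrable_norm)
    show "\<sigma> \<in> borel_measurable (lebesgue_on {0<..<t})"
    proof (rule measurable_cong[THEN iffD2])
      show "(\<lambda>x. Re (exp (s * of_real x) * laplace_integrand \<sigma> s x)) \<in> borel_measurable (lebesgue_on {0<..<t})"
        by (rule measurable_compose[where g = Re, OF borel_measurable_times[OF e borel_measurable_integrable[OF i]]])
           measurable
    qed (rule \<sigma>)
    have "\<bar>\<sigma> x\<bar> \<le> exp (\<bar>Re s\<bar> * t) * norm (laplace_integrand \<sigma> s x)" if "x \<in> {0<..<t}" for x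
    proof -
      have "\<bar>\<sigma> x\<bar> \<le> norm (exp (s * of_real x) * laplace_integrand \<sigma> s x)"
        using abs_Re_le_cmod \<sigma>[of x] by metis
      also have "\<dots> = exp (Re s * x) * norm (laplace_integrand \<sigma> s x)"
        by (simp add: norm_mult)
      also have "\<dots> \<le> exp (\<bar>Re s\<bar> * t) * norm (laplace_integrand \<sigma> s x)"
      proof (intro mult_right_mono)
        have "Re s * x \<le> \<bar>Re s\<bar> * x" using that by (intro mult_right_mono) auto
        also have "\<dots> \<le> \<bar>Re s\<bar> * t" using that by (intro mult_left_mono) auto
        finally show "exp (Re s * x) \<le> exp (\<bar>Re s\<bar> * t)" by simp
      qed simp
      finally show ?thesis .
    qed
    then show "AE x in lebesgue_on {0<..<t}. norm (\<sigma> x) \<le> norm (exp (\<bar>Re s\<bar> * t) * norm (laplace_integrand \<sigma> s x))"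
      by (intro AE_I2) (simp add: abs_mult)
  qed
qed

section \<open>The symbol of the time-fractional operator\<close>

text \<open>The symbol is stored as a function from orders of differentiation to total coefficients,
  not as a function of the Laplace variable. Models with different numbers of terms can so be
  subtracted. For a mode, A is c^2 \<lambda> and \<open>B k\<close> is b_k
  \<lambda>^\<beta>_k.\<close>

definition damping_symbol ::
  "real \<Rightarrow> nat \<Rightarrow> (nat \<Rightarrow> real) \<Rightarrow> (nat \<Rightarrow> real) \<Rightarrow> nat \<Rightarrow> (nat \<Rightarrow> real) \<Rightarrow> (nat \<Rightarrow> real) \<Rightarrow> real \<Rightarrow> real"
where
  "damping_symbol A N B \<alpha> J d \<gamma> \<mu> =
     (if 2 = \<mu> then 1 else 0) + (if 0 = \<mu> then A else 0) +
     (\<Sum>j=1..J. if 2 + \<gamma> j = \<mu> then d j else 0) + (\<Sum>k=1..N. if \<alpha> k = \<mu> then B k else 0)"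

lemma sum_damping_symbol:
  assumes "finite S" "0 \<in> S" "2 \<in> S" "\<alpha> ` {1..N} \<subseteq> S" "(\<lambda>j. 2 + \<gamma> j) ` {1..J} \<subseteq> S"
  shows "(\<Sum>\<mu>\<in>S. damping_symbol A N B \<alpha> J d \<gamma> \<mu> * R \<mu>) =
    R 2 + A * R 0 + (\<Sum>j=1..J. d j * R (2 + \<gamma> j)) + (\<Sum>k=1..N. B k * R (\<alpha> k))"
proof -
  have delta: "(\<Sum>\<mu>\<in>S. (if \<nu> = \<mu> then c else 0) * R \<mu>) = c * R \<nu>" if "\<nu> \<in> S" for \<nu> c :: real
  proof -
    have "(\<Sum>\<mu>\<in>S. (if \<nu> = \<mu> then c else 0) * R \<mu>) = (\<Sum>\<mu>\<in>S. if \<nu> = \<mu> then c * R \<mu> else 0)"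
      by (intro sum.cong) auto
    then show ?thesis using that assms(1) by simp
  qed
  have swap: "(\<Sum>\<mu>\<in>S. (\<Sum>k=1..m. if e k = \<mu> then c k else 0) * R \<mu>) = (\<Sum>k=1..m. c k * R (e k))"
    if "e ` {1..m} \<subseteq> S" for m and c e :: "nat \<Rightarrow> real"
  proof -
    have "(\<Sum>\<mu>\<in>S. (\<Sum>k=1..m. if e k = \<mu> then c k else 0) * R \<mu>) =
        (\<Sum>k=1..m. \<Sum>\<mu>\<in>S. (if e k = \<mu> then c k else 0) * R \<mu>)"
      unfolding sum_distrib_right by (rule sum.swap)
    also have "\<dots> = (\<Sum>k=1..m. c k * R (e k))"
      using that by (intro sum.cong refl delta) auto
    finally show ?thesis .
  qed
  show ?thesis
    unfolding damping_symbol_def distrib_right sum.distrib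
    using assms by (simp only: delta swap)
qed

section \<open>Recovering orders and coefficients from a symbol\<close>

lemma sum_delta_strict_mono_on:
  fixes e :: "nat \<Rightarrow> real" and c :: "nat \<Rightarrow> real"
  assumes "strict_mono_on {1..m} e" "k \<in> {1..m}"
  shows "(\<Sum>i=1..m. if e i = e k then c i else 0) = c k"
proof -
  have "inj_on e {1..m}" using assms(1) by (rule strict_mono_on_imp_inj_on)
  then have "(\<Sum>i=1..m. if e i = e k then c i else 0) = (\<Sum>i=1..m. if i = k then c i else 0)"
    using assms(2) by (intro sum.cong) (auto dest: inj_onD)
  also have "\<dots> = c k" using assms(2) by simp
  finally show ?thesis .
qed

text \<open>The orders of the four groups of terms lie in the disjoint sets {0}, (0, 1], {2} and (2,
  3], so no group interferes with another.\<close>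

lemma damping_symbol_at:
  assumes "\<forall>k\<in>{1..N}. 0 < \<alpha> k \<and> \<alpha> k \<le> 1" "\<forall>j\<in>{1..J}. 0 < \<gamma> j"
  shows "damping_symbol A N B \<alpha> J d \<gamma> 2 = 1"
    and "damping_symbol A N B \<alpha> J d \<gamma> 0 = A"
    and "0 < \<mu> \<Longrightarrow> \<mu> \<le> 1 \<Longrightarrow> damping_symbol A N B \<alpha> J d \<gamma> \<mu> = (\<Sum>k=1..N. if \<alpha> k = \<mu> then B k else 0)"
    and "0 < \<mu> \<Longrightarrow> damping_symbol A N B \<alpha> J d \<gamma> (2 + \<mu>) = (\<Sum>j=1..J. if \<gamma> j = \<mu> then d j else 0)"
proof -
  have *: "(\<Sum>j=1..J. if 2 + \<gamma> j = \<mu> then d j else 0) = 0" if "\<mu> \<le> 2" for \<mu>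
    using assms that by (intro sum.neutral) force
  have **: "(\<Sum>k=1..N. if \<alpha> k = \<mu> then B k else 0) = 0" if "\<mu> = 0 \<or> 1 < \<mu>" for \<mu>
    using assms that by (intro sum.neutral) force
  show "damping_symbol A N B \<alpha> J d \<gamma> 2 = 1" "damping_symbol A N B \<alpha> J d \<gamma> 0 = A"
    using *[of 2] **[of 2] *[of 0] **[of 0] by (simp_all add: damping_symbol_def)
  show "0 < \<mu> \<Longrightarrow> \<mu> \<le> 1 \<Longrightarrow> damping_symbol A N B \<alpha> J d \<gamma> \<mu> = (\<Sum>k=1..N. if \<alpha> k = \<mu> then B k else 0)"
    using *[of \<mu>] by (simp add: damping_symbol_def)
  show "0 < \<mu> \<Longrightarrow> damping_symbol A N B \<alpha> J d \<gamma> (2 + \<mu>) = (\<Sum>j=1..J. if \<gamma> j = \<mu> then d j else 0)"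
    using **[of "2 + \<mu>"] by (simp add: damping_symbol_def)
qed

text \<open>Both sequences are the unique increasing enumeration of the same finite set.\<close>

lemma strict_mono_on_image_eq:
  fixes e e' :: "nat \<Rightarrow> real"
  assumes "strict_mono_on {1..m} e" "strict_mono_on {1..m'} e'" and eq: "e ` {1..m} = e' ` {1..m'}"
  shows "m = m'" "\<forall>k\<in>{1..m}. e k = e' k"
proof -
  have L: "sorted_list_of_set (e ` {1..m}) = map e [1..<Suc m]" if "strict_mono_on {1..m} e"
    for m and e :: "nat \<Rightarrow> real"
  proof (rule sorted_list_of_set_unique[THEN iffD1])
    have "sorted_wrt (<) (map e [1..<Suc m])"
      unfolding sorted_wrt_map using that
      by (intro sorted_wrt_mono_rel[OF _ sorted_wrt_upt]) (auto simp: strict_mono_on_def)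
    then show "sorted_wrt (<) (map e [1..<Suc m]) \<and> set (map e [1..<Suc m]) = e ` {1..m} \<and>
        length (map e [1..<Suc m]) = card (e ` {1..m})"
      using card_image[OF strict_mono_on_imp_inj_on[OF that]] by auto
  qed simp
  have maps: "map e [1..<Suc m] = map e' [1..<Suc m']"
    using L[OF assms(1)] L[OF assms(2)] eq by simp
  from map_eq_imp_length_eq[OF this] show m: "m = m'"
    unfolding length_upt by simp
  show "\<forall>k\<in>{1..m}. e k = e' k"
    using maps unfolding m[symmetric] map_eq_conv by auto
qed

text \<open>As the coefficients are nonzero, the exponents form exactly the support of the function
  of x; equal supports have equal enumerations, and the values on the support are the
  coefficients.\<close>

lemma exponent_sum_unique:
  fixes e e' c c' :: "nat \<Rightarrow> real"
  assumes mono: "strict_mono_on {1..m} e" "strict_mono_on {1..m'} e'"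
    and nz: "\<forall>k\<in>{1..m}. c k \<noteq> 0 \<and> e k \<in> I" "\<forall>k\<in>{1..m'}. c' k \<noteq> 0 \<and> e' k \<in> I"
    and eq: "\<And>x. x \<in> I \<Longrightarrow> (\<Sum>k=1..m. if e k = x then c k else 0) = (\<Sum>k=1..m'. if e' k = x then c' k else 0)"
  shows "m = m'" "\<forall>k\<in>{1..m}. e k = e' k \<and> c k = c' k"
proof -
  have supp: "e k \<in> e' ` {1..m'}"
    if "strict_mono_on {1..m} e" "\<forall>k\<in>{1..m}. c k \<noteq> 0 \<and> e k \<in> I" "k \<in> {1..m}"
      "\<And>x. x \<in> I \<Longrightarrow> (\<Sum>k=1..m. if e k = x then c k else 0) = (\<Sum>k=1..m'. if e' k = x then c' k else 0)"
    for e e' c c' :: "nat \<Rightarrow> real" and m m' k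
  proof (rule ccontr)
    assume "e k \<notin> e' ` {1..m'}"
    then have "(\<Sum>i=1..m'. if e' i = e k then c' i else 0) = 0"
      by (intro sum.neutral) force
    then show False
      using that sum_delta_strict_mono_on[OF that(1,3), of c] by simp
  qed
  have "e ` {1..m} = e' ` {1..m'}"
    using supp[OF mono(1) nz(1) _ eq] supp[OF mono(2) nz(2) _ eq[symmetric]] by blast
  from strict_mono_on_image_eq[OF mono this] have m: "m = m'" and e: "\<forall>k\<in>{1..m}. e k = e' k" .
  show "m = m'" by fact
  have "c k = c' k" if "k \<in> {1..m}" for k
    using eq[of "e k"] sum_delta_strict_mono_on[OF mono(1) that, of c]
      sum_delta_strict_mono_on[OF mono(2), of k c'] e m nz that by simp
  then show "\<forall>k\<in>{1..m}. e k = e' k \<and> c k = c' k" using e by blast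
qed


section \<open>Modes of the damped wave equation\<close>

lemma eigensystem_L2: "eigensystem \<Omega> \<A> lam \<phi> \<Longrightarrow> \<phi> m \<in> L2 (lebesgue_on \<Omega>)"
  by (simp add: eigensystem_def)

text \<open>Supplies the functions \<open>h k\<close> needed to test the wave equation with an
  eigenfunction; off the diagonal both sides vanish by orthogonality.\<close>

lemma spectral_power_eigenfunction:
  assumes "eigensystem \<Omega> \<A> lam \<phi>"
  shows "spectral_power \<Omega> lam \<phi> s (\<phi> m) (\<lambda>x. lam m powr s * \<phi> m x)"
proof -
  have \<phi>: "\<phi> n \<in> L2 (lebesgue_on \<Omega>)" for n
    using assms by (rule eigensystem_L2)
  have "inner_L2 (lebesgue_on \<Omega>) (\<lambda>x. lam m powr s * \<phi> m x) (\<phi> n) =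
      lam n powr s * inner_L2 (lebesgue_on \<Omega>) (\<phi> m) (\<phi> n)" for n
  proof (cases "m = n")
    case False
    then have "inner_L2 (lebesgue_on \<Omega>) (\<phi> m) (\<phi> n) = 0"
      using assms by (simp add: eigensystem_def)
    then show ?thesis by (simp add: inner_L2_def mult.assoc)
  qed (simp add: inner_L2_def mult.assoc)
  moreover have "(\<lambda>x. lam m powr s * \<phi> m x) \<in> L2 (lebesgue_on \<Omega>)"
    by (rule L2_cmult[OF \<phi>])
  ultimately show ?thesis
    using \<phi> by (simp add: spectral_power_def)
qed

lemma mode_regular:
  assumes "damped_wave_solution \<Omega> \<A> lam \<phi> N J c b \<alpha> \<beta> d \<gamma> T \<sigma> f u" "v \<in> L2 (lebesgue_on \<Omega>)"
  obtains n where "2 \<le> n" "n \<le> 3" "J \<noteq> 0 \<Longrightarrow> n = 3"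
    "time_regular n T (\<lambda>t. inner_L2 (lebesgue_on \<Omega>) (u t) v)"
    "vanishing_initial_data n (\<lambda>t. inner_L2 (lebesgue_on \<Omega>) (u t) v)"
proof (rule that[of "if J = 0 then 2 else 3"])
  show "time_regular (if J = 0 then 2 else 3) T (\<lambda>t. inner_L2 (lebesgue_on \<Omega>) (u t) v)"
    "vanishing_initial_data (if J = 0 then 2 else 3) (\<lambda>t. inner_L2 (lebesgue_on \<Omega>) (u t) v)"
    using assms unfolding damped_wave_solution_def Let_def by blast+
qed auto

text \<open>The equation tested with the m-th eigenfunction. The factor
  \<open>lam m powr \<beta> k\<close> stays inside \<open>caputo\<close>, because
  \<open>deriv\<close> has an unspecified value where no derivative exists and need not commute with
  multiplication there.\<close>

lemma mode_AE_equation: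
  assumes sol: "damped_wave_solution \<Omega> \<A> lam \<phi> N J c b \<alpha> \<beta> d \<gamma> T \<sigma> f u"
    and eig: "eigensystem \<Omega> \<A> lam \<phi>"
    and w: "w = (\<lambda>t. inner_L2 (lebesgue_on \<Omega>) (u t) (\<phi> m))"
  shows "AE t in lebesgue_on {0<..<T}.
    caputo 2 w t + c\<^sup>2 * lam m * w t + (\<Sum>j=1..J. d j * caputo (2 + \<gamma> j) w t) +
    (\<Sum>k=1..N. b k * caputo (\<alpha> k) (\<lambda>s. lam m powr \<beta> k * w s) t) =
    inner_L2 (lebesgue_on \<Omega>) f (\<phi> m) * \<sigma> t"
proof -
  have "\<A> (\<phi> m) (\<lambda>x. lam m * \<phi> m x)"
    using eig by (simp add: eigensystem_def)
  then have "AE t in lebesgue_on {0<..<T}.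
    (deriv ^^ 2) w t + c\<^sup>2 * inner_L2 (lebesgue_on \<Omega>) (u t) (\<lambda>x. lam m * \<phi> m x) +
    (\<Sum>j=1..J. d j * caputo (2 + \<gamma> j) w t) +
    (\<Sum>k=1..N. b k * caputo (\<alpha> k)
      (\<lambda>s. inner_L2 (lebesgue_on \<Omega>) (u s) ((\<lambda>k x. lam m powr \<beta> k * \<phi> m x) k)) t) =
    \<sigma> t * inner_L2 (lebesgue_on \<Omega>) f (\<phi> m)"
    unfolding w
    by (rule sol[unfolded damped_wave_solution_def, THEN conjunct2, THEN conjunct2, rule_format])
       (rule spectral_power_eigenfunction[OF eig])
  moreover have "caputo 2 w = (deriv ^^ 2) w"
    by (simp add: caputo_def fun_eq_iff)
  ultimately show ?thesis
    by (simp add: inner_L2_cmult_right w mult.assoc mult.commute[of _ "inner_L2 _ f _"])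
qed

section \<open>The integrated scalar equation of a mode\<close>

lemma time_regular_continuous_integrable:
  assumes "time_regular n T w" "vanishing_initial_data n w" "1 \<le> n"
  shows "continuous_on {0<..<T} w" "t \<in> {0<..<T} \<Longrightarrow> integrable (lebesgue_on {0<..<t}) w"
proof -
  have eq: "rl_integral 1 (deriv w) t = w t" if "t \<in> {0<..<T}" for t
    using rl_integral_1_deriv[OF assms(1,2), of 0 t] assms that by simp
  have int: "integrable (lebesgue_on {0<..<t}) (deriv w)" if "t \<in> {0<..<T}" for t
    using time_regular_integrable[OF assms(1), of 0 t] assms that by simp
  have "continuous_on {0<..<T} (rl_integral 1 (deriv w))"
    using int by (intro continuous_on_rl_integral_1) auto
  then show "continuous_on {0<..<T} w"
    by (rule continuous_on_eq) (rule eq)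
  show "integrable (lebesgue_on {0<..<t}) w" if t: "t \<in> {0<..<T}"
  proof -
    have "integrable (lebesgue_on {0<..<t}) (rl_integral 1 (deriv w))"
      by (intro rl_integral_integrable int t) simp
    then show ?thesis
      by (rule Bochner_Integration.integrable_cong[THEN iffD1, rotated 2]) (use eq t in auto)
  qed
qed

text \<open>A finite index set that may be larger than the set of orders of one model, so that two
  models can share it. The upper bound 3 keeps 4 - \<mu> at least 1.\<close>

definition admissible_orders ::
  "real set \<Rightarrow> nat \<Rightarrow> (nat \<Rightarrow> real) \<Rightarrow> nat \<Rightarrow> (nat \<Rightarrow> real) \<Rightarrow> bool"
where
  "admissible_orders S N \<alpha> J \<gamma> \<longleftrightarrow> finite S \<and> S \<subseteq> {0..3} \<and> 0 \<in> S \<and> 2 \<in> S \<and>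
     \<alpha> ` {1..N} \<subseteq> S \<and> (\<lambda>j. 2 + \<gamma> j) ` {1..J} \<subseteq> S"

text \<open>
  Integrating four times leaves only integrals of order at least one, whose kernels are
  bounded, so all terms are defined for every \<open>t\<close> and not just almost everywhere.
\<close>

lemma mode_integrated_equation:
  assumes sol: "damped_wave_solution \<Omega> \<A> lam \<phi> N J c b \<alpha> \<beta> d \<gamma> T \<sigma> f u"
    and eig: "eigensystem \<Omega> \<A> lam \<phi>"
    and par: "damping_parameters N J c b \<alpha> \<beta> d \<gamma>"
    and \<sigma>: "laplace_domain \<sigma> \<noteq> {}"
    and w: "w = (\<lambda>t. inner_L2 (lebesgue_on \<Omega>) (u t) (\<phi> m))"
    and S: "admissible_orders S N \<alpha> J \<gamma>" and t: "t \<in> {0<..<T}"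
  shows "(\<Sum>\<mu>\<in>S. damping_symbol (c\<^sup>2 * lam m) N (\<lambda>k. b k * lam m powr \<beta> k) \<alpha> J d \<gamma> \<mu> *
      rl_integral (4 - \<mu>) w t) = inner_L2 (lebesgue_on \<Omega>) f (\<phi> m) * rl_integral 4 \<sigma> t"
proof -
  let ?F = "inner_L2 (lebesgue_on \<Omega>) f (\<phi> m)"
  let ?G1 = "\<lambda>s. caputo 2 w s" and ?G2 = "\<lambda>s. c\<^sup>2 * lam m * w s"
    and ?G3 = "\<lambda>s. \<Sum>j=1..J. d j * caputo (2 + \<gamma> j) w s"
    and ?G4 = "\<lambda>s. \<Sum>k=1..N. b k * caputo (\<alpha> k) (\<lambda>s. lam m powr \<beta> k * w s) s"
  have orders: "0 < \<alpha> k" "\<alpha> k \<le> 1" if "k \<in> {1..N}" for k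
    using par that by (auto simp: damping_parameters_def)
  have orders': "0 < \<gamma> j" "\<gamma> j \<le> 1" if "j \<in> {1..J}" for j
    using par that by (auto simp: damping_parameters_def)
  have \<phi>: "\<phi> m \<in> L2 (lebesgue_on \<Omega>)"
    by (rule eigensystem_L2[OF eig])
  obtain n where n: "2 \<le> n" "n \<le> 3" "J \<noteq> 0 \<Longrightarrow> n = 3" "time_regular n T w" "vanishing_initial_data n w"
    using mode_regular[OF sol \<phi>] unfolding w by blast
  have caputo_Aw: "integrable (lebesgue_on {0<..<t}) (caputo (\<alpha> k) (\<lambda>s. lam m powr \<beta> k * w s))"
    "rl_integral 4 (caputo (\<alpha> k) (\<lambda>s. lam m powr \<beta> k * w s)) t =
      lam m powr \<beta> k * rl_integral (4 - \<alpha> k) w t" if k: "k \<in> {1..N}" for k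
  proof -
    \<comment> \<open>The scaled eigenfunction is used as a test function in its own right, which
      gives the regularity of the scaled mode directly; the factor is pulled out only after
      integration.\<close>
    have "(\<lambda>x. lam m powr \<beta> k * \<phi> m x) \<in> L2 (lebesgue_on \<Omega>)"
      by (rule L2_cmult[OF \<phi>])
    from mode_regular[OF sol this] obtain n where n: "2 \<le> n"
      "time_regular n T (\<lambda>s. lam m powr \<beta> k * w s)" "vanishing_initial_data n (\<lambda>s. lam m powr \<beta> k * w s)"
      unfolding w inner_L2_cmult_right by blast
    have "0 < \<alpha> k" "\<alpha> k \<le> real n"
      using orders[OF k] n by auto
    note c = rl_integral_caputo[OF n(2,3) this t]
    show "integrable (lebesgue_on {0<..<t}) (caputo (\<alpha> k) (\<lambda>s. lam m powr \<beta> k * w s))"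
      by (rule c(1))
    show "rl_integral 4 (caputo (\<alpha> k) (\<lambda>s. lam m powr \<beta> k * w s)) t =
        lam m powr \<beta> k * rl_integral (4 - \<alpha> k) w t"
      using c(2)[of 4] orders[OF k] by (simp add: rl_integral_cmult)
  qed
  note caputo_w = rl_integral_caputo[OF n(4,5) _ _ t]
  have "1 \<le> n" using n by simp
  note w_int = time_regular_continuous_integrable(2)[OF n(4,5) this t]
  have I1: "integrable (lebesgue_on {0<..<t}) ?G1" "rl_integral 4 ?G1 t = rl_integral (4 - 2) w t"
    using caputo_w[of 2] n by auto
  have I2: "integrable (lebesgue_on {0<..<t}) ?G2"
    using w_int by simp
  have I3: "integrable (lebesgue_on {0<..<t}) (\<lambda>s. d j * caputo (2 + \<gamma> j) w s)"
    "rl_integral 4 (\<lambda>s. d j * caputo (2 + \<gamma> j) w s) t = d j * rl_integral (4 - (2 + \<gamma> j)) w t"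
    if "j \<in> {1..J}" for j
    using caputo_w[of "2 + \<gamma> j"] n that orders'[OF that] unfolding rl_integral_cmult by auto
  have I4: "integrable (lebesgue_on {0<..<t}) (\<lambda>s. b k * caputo (\<alpha> k) (\<lambda>s. lam m powr \<beta> k * w s) s)"
    "rl_integral 4 (\<lambda>s. b k * caputo (\<alpha> k) (\<lambda>s. lam m powr \<beta> k * w s) s) t =
      b k * lam m powr \<beta> k * rl_integral (4 - \<alpha> k) w t"
    if "k \<in> {1..N}" for k
    using caputo_Aw[OF that] by (simp_all add: rl_integral_cmult)
  have \<sigma>i: "integrable (lebesgue_on {0<..<t}) \<sigma>"
    by (rule laplace_domain_integrable[OF \<sigma>])
  have I: "integrable (lebesgue_on {0<..<t}) ?G3" "integrable (lebesgue_on {0<..<t}) ?G4"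
    using I3 I4 by (auto intro!: Bochner_Integration.integrable_sum)
  have "rl_integral 4 ?G3 t = (\<Sum>j=1..J. rl_integral 4 (\<lambda>s. d j * caputo (2 + \<gamma> j) w s) t)"
    by (rule rl_integral_sum) (use I3(1) in simp_all)
  also have "\<dots> = (\<Sum>j=1..J. d j * rl_integral (4 - (2 + \<gamma> j)) w t)"
    by (rule sum.cong[OF refl I3(2)])
  finally have S3: "rl_integral 4 ?G3 t = (\<Sum>j=1..J. d j * rl_integral (4 - (2 + \<gamma> j)) w t)" .
  have "rl_integral 4 ?G4 t = (\<Sum>k=1..N. rl_integral 4
      (\<lambda>s. b k * caputo (\<alpha> k) (\<lambda>s. lam m powr \<beta> k * w s) s) t)"
    by (rule rl_integral_sum) (use I4(1) in simp_all)
  also have "\<dots> = (\<Sum>k=1..N. b k * lam m powr \<beta> k * rl_integral (4 - \<alpha> k) w t)"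
    by (rule sum.cong[OF refl I4(2)])
  finally have S4: "rl_integral 4 ?G4 t =
      (\<Sum>k=1..N. b k * lam m powr \<beta> k * rl_integral (4 - \<alpha> k) w t)" .
  have "rl_integral 4 (\<lambda>s. ?G1 s + ?G2 s + ?G3 s + ?G4 s) t = rl_integral 4 (\<lambda>s. ?F * \<sigma> s) t"
  proof (rule rl_integral_cong_AE)
    show "(\<lambda>s. ?G1 s + ?G2 s + ?G3 s + ?G4 s) \<in> borel_measurable (lebesgue_on {0<..<t})"
      by (intro borel_measurable_integrable Bochner_Integration.integrable_add I1 I2 I)
    show "(\<lambda>s. ?F * \<sigma> s) \<in> borel_measurable (lebesgue_on {0<..<t})"
      by (intro borel_measurable_integrable integrable_mult_right \<sigma>i)
    have "AE s in lebesgue. s \<in> {0<..<T} \<longrightarrow> ?G1 s + ?G2 s + ?G3 s + ?G4 s = ?F * \<sigma> s"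
      using mode_AE_equation[OF sol eig w] by (simp add: AE_restrict_space_iff)
    then show "AE s in lebesgue_on {0<..<t}. ?G1 s + ?G2 s + ?G3 s + ?G4 s = ?F * \<sigma> s"
      using t by (auto simp: AE_restrict_space_iff elim!: eventually_mono)
  qed
  also have "rl_integral 4 (\<lambda>s. ?G1 s + ?G2 s + ?G3 s + ?G4 s) t =
      rl_integral 4 ?G1 t + rl_integral 4 ?G2 t + rl_integral 4 ?G3 t + rl_integral 4 ?G4 t"
    using I1 I2 I by (simp add: rl_integral_add)
  also have "\<dots> = rl_integral (4 - 2) w t + c\<^sup>2 * lam m * rl_integral (4 - 0) w t +
      (\<Sum>j=1..J. d j * rl_integral (4 - (2 + \<gamma> j)) w t) +
      (\<Sum>k=1..N. b k * lam m powr \<beta> k * rl_integral (4 - \<alpha> k) w t)"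
    by (simp only: I1(2) S3 S4 rl_integral_cmult diff_zero)
  also have "\<dots> = (\<Sum>\<mu>\<in>S. damping_symbol (c\<^sup>2 * lam m) N (\<lambda>k. b k * lam m powr \<beta> k) \<alpha> J d \<gamma> \<mu> *
      rl_integral (4 - \<mu>) w t)"
    using S unfolding admissible_orders_def by (subst sum_damping_symbol) auto
  finally show ?thesis
    by (simp add: rl_integral_cmult)
qed

section \<open>Only the excited mode is present in the solution\<close>

lemma admissible_orders_exist:
  assumes "damping_parameters N J c b \<alpha> \<beta> d \<gamma>" "damping_parameters N' J' c' b' \<alpha>' \<beta>' d' \<gamma>'"
    and "0 \<le> \<mu>" "\<mu> \<le> 3"
  obtains S where "admissible_orders S N \<alpha> J \<gamma>" "admissible_orders S N' \<alpha>' J' \<gamma>'" "\<mu> \<in> S"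
proof -
  \<comment> \<open>The additional order \<mu> allows symbols to be compared at any point of [0, 3],
    also where neither model has a term.\<close>
  let ?S = "{0, 2, \<mu>} \<union> \<alpha> ` {1..N} \<union> (\<lambda>j. 2 + \<gamma> j) ` {1..J} \<union> \<alpha>' ` {1..N'} \<union> (\<lambda>j. 2 + \<gamma>' j) ` {1..J'}"
  have "finite ?S" by auto
  moreover have "?S \<subseteq> {0..3}"
    using assms by (force simp: damping_parameters_def)
  ultimately have "admissible_orders ?S N \<alpha> J \<gamma>" "admissible_orders ?S N' \<alpha>' J' \<gamma>'"
    unfolding admissible_orders_def by auto
  then show ?thesis by (rule that) auto
qed

text \<open>The source is orthogonal to the m-th eigenfunction, so this mode solves a homogeneous
  equation whose symbol is nonzero at order 2.\<close>

lemma mode_vanishes: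
  assumes sol: "damped_wave_solution \<Omega> \<A> lam \<phi> N J c b \<alpha> \<beta> d \<gamma> T \<sigma> (\<phi> l) u"
    and eig: "eigensystem \<Omega> \<A> lam \<phi>"
    and par: "damping_parameters N J c b \<alpha> \<beta> d \<gamma>"
    and \<sigma>: "laplace_domain \<sigma> \<noteq> {}" and "m \<noteq> l" and t: "t \<in> {0<..<T}"
  shows "inner_L2 (lebesgue_on \<Omega>) (u t) (\<phi> m) = 0"
proof -
  define w where "w = (\<lambda>t. inner_L2 (lebesgue_on \<Omega>) (u t) (\<phi> m))"
  obtain S where S: "admissible_orders S N \<alpha> J \<gamma>" "2 \<in> S"
    using admissible_orders_exist[OF par par, of 2] by auto
  obtain n where n: "2 \<le> n" "time_regular n T w" "vanishing_initial_data n w"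
    using mode_regular[OF sol eigensystem_L2[OF eig]] unfolding w_def by blast
  have "1 \<le> n" using n by simp
  note reg = time_regular_continuous_integrable[OF n(2,3) this]
  have 0: "inner_L2 (lebesgue_on \<Omega>) (\<phi> l) (\<phi> m) = 0"
    using eig \<open>m \<noteq> l\<close> by (simp add: eigensystem_def)
  have "w t = 0"
  proof (rule rl_integral_independent[where S = S and T = T and w = w and \<mu> = 2 and
        E = "damping_symbol (c\<^sup>2 * lam m) N (\<lambda>k. b k * lam m powr \<beta> k) \<alpha> J d \<gamma>"])
    show "damping_symbol (c\<^sup>2 * lam m) N (\<lambda>k. b k * lam m powr \<beta> k) \<alpha> J d \<gamma> 2 \<noteq> 0"
      using par by (subst damping_symbol_at(1)) (auto simp: damping_parameters_def)
  qed (use S reg t mode_integrated_equation[OF sol eig par \<sigma> w_def S(1)] 0 in \<open>auto simp: admissible_orders_def\<close>)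
  then show ?thesis by (simp add: w_def)
qed

text \<open>By completeness of the eigenfunctions, u(t) minus its projection onto the excited
  eigenfunction is zero almost everywhere, and B does not see null sets.\<close>

lemma observation_mode:
  assumes sol: "damped_wave_solution \<Omega> \<A> lam \<phi> N J c b \<alpha> \<beta> d \<gamma> T \<sigma> (\<phi> l) u"
    and eig: "eigensystem \<Omega> \<A> lam \<phi>"
    and par: "damping_parameters N J c b \<alpha> \<beta> d \<gamma>"
    and \<sigma>: "laplace_domain \<sigma> \<noteq> {}" and t: "t \<in> {0<..<T}"
    and obs: "observation_functional \<Omega> D B" "\<phi> l \<in> D"
  shows "B (u t) = inner_L2 (lebesgue_on \<Omega>) (u t) (\<phi> l) * B (\<phi> l)"
proof -
  let ?r = "inner_L2 (lebesgue_on \<Omega>) (u t) (\<phi> l)"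
  have \<phi>: "\<phi> m \<in> L2 (lebesgue_on \<Omega>)" for m
    by (rule eigensystem_L2[OF eig])
  have u: "u t \<in> L2 (lebesgue_on \<Omega>)"
    using sol t by (auto simp: damped_wave_solution_def)
  have "inner_L2 (lebesgue_on \<Omega>) (\<lambda>x. u t x - ?r * \<phi> l x) (\<phi> m) = 0" for m
    using mode_vanishes[OF sol eig par \<sigma> _ t, of m] eig
    by (subst inner_L2_diff_cmult_left[OF u \<phi> \<phi>]) (auto simp: eigensystem_def)
  moreover have "(\<lambda>x. u t x - ?r * \<phi> l x) \<in> L2 (lebesgue_on \<Omega>)"
    by (rule L2_diff_cmult[OF u \<phi>])
  ultimately have "AE x in lebesgue_on \<Omega>. u t x - ?r * \<phi> l x = 0"
    using eig unfolding eigensystem_def by blast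
  then have "AE x in lebesgue_on \<Omega>. u t x = ?r * \<phi> l x"
    by (auto elim: eventually_mono)
  \<comment> \<open>The multiple of the eigenfunction lies in D; closure of D under equality almost
    everywhere then puts u(t) itself into the domain of B.\<close>
  moreover have D: "(\<lambda>x. ?r * \<phi> l x) \<in> D" "B (\<lambda>x. ?r * \<phi> l x) = ?r * B (\<phi> l)"
    using obs unfolding observation_functional_def by blast+
  ultimately show ?thesis
    using obs(1) unfolding observation_functional_def by metis
qed

section \<open>Nonvanishing of the excited mode and comparison of two models\<close>

lemma funpow_deriv_zero:
  assumes "\<And>t. t \<in> {0<..<T} \<Longrightarrow> w t = (0::real)"
  shows "t \<in> {0<..<T} \<Longrightarrow> (deriv ^^ k) w t = 0"
proof (induction k arbitrary: t)
  case 0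
  then show ?case using assms by simp
next
  case (Suc k)
  \<comment> \<open>Derivatives are local, and the interval is open: nothing is known about w
    outside it.\<close>
  have "eventually (\<lambda>s. (deriv ^^ k) w s = 0) (nhds t)"
    using Suc by (intro eventually_nhds_in_open[of "{0<..<T}", THEN eventually_mono]) auto
  then have "deriv ((deriv ^^ k) w) t = deriv (\<lambda>s. 0) t"
    by (intro deriv_cong_ev) auto
  then show ?case by simp
qed

lemma caputo_zero:
  assumes "\<And>t. t \<in> {0<..<T} \<Longrightarrow> w t = 0" "t \<in> {0<..<T}"
  shows "caputo \<mu> w t = 0"
proof -
  have 0: "(deriv ^^ k) w s = 0" if "s \<in> {0<..<T}" for k s
    by (rule funpow_deriv_zero[of T w]) (use assms that in auto)
  have "(LINT s|lebesgue_on {0<..<t}. f s * (deriv ^^ k) w s) = (LINT s|lebesgue_on {0<..<t}. 0)" for f k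
    using 0 assms(2) by (intro Bochner_Integration.integral_cong) auto
  then show ?thesis
    using 0 assms(2) by (simp add: caputo_def Let_def)
qed

text \<open>Were the mode zero on (0, T), every term on the left would vanish there, the Caputo
  derivatives included since they only look back to time 0. The equation would force \<sigma> = 0
  almost everywhere.\<close>

lemma mode_nonzero:
  assumes sol: "damped_wave_solution \<Omega> \<A> lam \<phi> N J c b \<alpha> \<beta> d \<gamma> T \<sigma> (\<phi> l) u"
    and eig: "eigensystem \<Omega> \<A> lam \<phi>"
    and \<sigma>: "\<not> (AE t in lebesgue_on {0<..<T}. \<sigma> t = 0)"
  obtains t where "t \<in> {0<..<T}" "inner_L2 (lebesgue_on \<Omega>) (u t) (\<phi> l) \<noteq> 0"
proof (rule ccontr)
  define w where "w = (\<lambda>t. inner_L2 (lebesgue_on \<Omega>) (u t) (\<phi> l))"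
  assume "\<not> thesis"
  with that have w0: "w t = 0" if "t \<in> {0<..<T}" for t
    using that unfolding w_def by blast
  have c: "caputo \<mu> (\<lambda>s. r * w s) t = 0" if "t \<in> {0<..<T}" for \<mu> r t
    using w0 that by (intro caputo_zero[of T]) auto
  have 1: "inner_L2 (lebesgue_on \<Omega>) (\<phi> l) (\<phi> l) = 1"
    using eig by (simp add: eigensystem_def)
  have "AE t in lebesgue. t \<in> {0<..<T} \<longrightarrow> \<sigma> t = 0"
    using mode_AE_equation[OF sol eig w_def] c[of _ _ 1] c w0
    by (auto simp: AE_restrict_space_iff 1 elim!: eventually_mono)
  then show False
    using \<sigma> by (simp add: AE_restrict_space_iff)
qed

text \<open>Equal observations make the two excited modes proportional, and both integrated
  equations have the same right-hand side. Their difference is a homogeneous relation for one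
  nonzero mode, which \<open>rl_integral_independent\<close> excludes unless all coefficients
  cancel.\<close>

lemma damping_symbols_agree:
  assumes sol: "damped_wave_solution \<Omega> \<A> lam \<phi> N J c b \<alpha> \<beta> d \<gamma> T \<sigma> (\<phi> l) u"
    and sol': "damped_wave_solution \<Omega> \<A>' lam' \<phi>' N' J' c' b' \<alpha>' \<beta>' d' \<gamma>' T \<sigma> (\<phi>' l') u'"
    and eig: "eigensystem \<Omega> \<A> lam \<phi>" and eig': "eigensystem \<Omega> \<A>' lam' \<phi>'"
    and par: "damping_parameters N J c b \<alpha> \<beta> d \<gamma>" and par': "damping_parameters N' J' c' b' \<alpha>' \<beta>' d' \<gamma>'"
    and \<sigma>: "laplace_domain \<sigma> \<noteq> {}" "\<not> (AE t in lebesgue_on {0<..<T}. \<sigma> t = 0)"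
    and obs: "observation_functional \<Omega> D B" "\<phi> l \<in> D" "B (\<phi> l) \<noteq> 0"
    and obs': "observation_functional \<Omega> D' B'" "\<phi>' l' \<in> D'" "B' (\<phi>' l') \<noteq> 0"
    and eq: "\<And>t. t \<in> {0<..<T} \<Longrightarrow> B (u t) = B' (u' t)"
    and \<mu>: "0 \<le> \<mu>" "\<mu> \<le> 3"
  shows "damping_symbol (c\<^sup>2 * lam l) N (\<lambda>k. b k * lam l powr \<beta> k) \<alpha> J d \<gamma> \<mu> =
    damping_symbol (c'\<^sup>2 * lam' l') N' (\<lambda>k. b' k * lam' l' powr \<beta>' k) \<alpha>' J' d' \<gamma>' \<mu>"
    (is "?E \<mu> = ?E' \<mu>")
proof -
  define w where "w = (\<lambda>t. inner_L2 (lebesgue_on \<Omega>) (u t) (\<phi> l))"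
  define w' where "w' = (\<lambda>t. inner_L2 (lebesgue_on \<Omega>) (u' t) (\<phi>' l'))"
  \<comment> \<open>Obtained by solving w B(\<phi>_l) = w' B'(\<phi>'_l') for w'.\<close>
  define \<kappa> where "\<kappa> = B (\<phi> l) / B' (\<phi>' l')"
  have w': "w' t = \<kappa> * w t" if "t \<in> {0<..<T}" for t
    using observation_mode[OF sol eig par \<sigma>(1) that obs(1,2)]
      observation_mode[OF sol' eig' par' \<sigma>(1) that obs'(1,2)] eq[OF that] obs'(3)
    by (simp add: \<kappa>_def w_def w'_def field_simps)
  obtain n where n: "2 \<le> n" "time_regular n T w" "vanishing_initial_data n w"
    using mode_regular[OF sol eigensystem_L2[OF eig]] unfolding w_def by blast
  have "1 \<le> n" using n by simp
  note reg = time_regular_continuous_integrable[OF n(2,3) this]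
  obtain t\<^sub>0 where t\<^sub>0: "t\<^sub>0 \<in> {0<..<T}" "w t\<^sub>0 \<noteq> 0"
    using mode_nonzero[OF sol eig \<sigma>(2)] unfolding w_def by blast
  have 1: "inner_L2 (lebesgue_on \<Omega>) (\<phi> l) (\<phi> l) = 1" "inner_L2 (lebesgue_on \<Omega>) (\<phi>' l') (\<phi>' l') = 1"
    using eig eig' by (simp_all add: eigensystem_def)
  have proportional: "?E \<nu> = \<kappa> * ?E' \<nu>" if \<nu>: "0 \<le> \<nu>" "\<nu> \<le> 3" for \<nu>
  proof (rule ccontr)
    assume ne: "?E \<nu> \<noteq> \<kappa> * ?E' \<nu>"
    \<comment> \<open>The order \<nu> must belong to S, as it is the place where the coefficient of
      the difference is nonzero.\<close>
    obtain S where S: "admissible_orders S N \<alpha> J \<gamma>" "admissible_orders S N' \<alpha>' J' \<gamma>'" "\<nu> \<in> S"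
      using admissible_orders_exist[OF par par' \<nu>] .
    have "(\<Sum>\<mu>\<in>S. (?E \<mu> - \<kappa> * ?E' \<mu>) * rl_integral (4 - \<mu>) w t) = 0" if t: "t \<in> {0<..<T}" for t
    proof -
      have w'_eq: "rl_integral a w' t = \<kappa> * rl_integral a w t" for a
        unfolding rl_integral_cmult[symmetric] using w' t by (intro rl_integral_cong) auto
      have "(\<Sum>\<mu>\<in>S. ?E \<mu> * rl_integral (4 - \<mu>) w t) = rl_integral 4 \<sigma> t"
        using mode_integrated_equation[OF sol eig par \<sigma>(1) w_def S(1) t] by (simp add: 1)
      moreover have "(\<Sum>\<mu>\<in>S. ?E' \<mu> * (\<kappa> * rl_integral (4 - \<mu>) w t)) = rl_integral 4 \<sigma> t"
        using mode_integrated_equation[OF sol' eig' par' \<sigma>(1) w'_def S(2) t] by (simp add: 1 w'_eq)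
      moreover have "(?E \<mu> - \<kappa> * ?E' \<mu>) * rl_integral (4 - \<mu>) w t =
          ?E \<mu> * rl_integral (4 - \<mu>) w t - ?E' \<mu> * (\<kappa> * rl_integral (4 - \<mu>) w t)" for \<mu>
        by algebra
      ultimately show ?thesis
        by (simp only: sum_subtractf)
    qed
    then have "w t\<^sub>0 = 0"
      using S reg t\<^sub>0 ne
      by (intro rl_integral_independent[where S = S and T = T and w = w and \<mu> = \<nu> and
            E = "\<lambda>\<mu>. ?E \<mu> - \<kappa> * ?E' \<mu>"]) (auto simp: admissible_orders_def)
    with t\<^sub>0 show False by simp
  qed
  \<comment> \<open>The term u_tt has coefficient 1 in both models, which fixes the factor of
    proportionality.\<close>
  have "?E 2 = 1" "?E' 2 = 1"
    using par par' by (auto simp: damping_parameters_def intro!: damping_symbol_at(1))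
  then have "\<kappa> = 1"
    using proportional[of 2] by simp
  then show ?thesis
    using proportional[OF \<mu>] by simp
qed


section \<open>Identification of the parameters\<close>

theorem theorem3p2:
  fixes \<Omega> :: "(real^'d) set" and T :: real and \<sigma> :: "real \<Rightarrow> real"
    and a a' :: "real^'d \<Rightarrow> real^'d^'d" and q q' :: "real^'d \<Rightarrow> real"
    and bc bc' :: "'d boundary_condition"
    and lam lam' :: "nat \<Rightarrow> real" and \<phi> \<phi>' :: "nat \<Rightarrow> real^'d \<Rightarrow> real"
    and N N' J J' :: nat and c c' :: real
    and b b' \<alpha> \<alpha>' \<beta> \<beta>' d d' \<gamma> \<gamma>' :: "nat \<Rightarrow> real"
    and n n' :: "nat \<Rightarrow> nat"
    and D D' :: "nat \<Rightarrow> (real^'d \<Rightarrow> real) set"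
    and B B' :: "nat \<Rightarrow> (real^'d \<Rightarrow> real) \<Rightarrow> real"
    and u u' :: "nat \<Rightarrow> real \<Rightarrow> real^'d \<Rightarrow> real"
  assumes "open \<Omega>" and "0 < T"
    and "elliptic_coefficients \<Omega> a q bc"
    and "elliptic_coefficients \<Omega> a' q' bc'"
    and "eigensystem \<Omega> (elliptic_operator \<Omega> a q bc) lam \<phi>"
    and "eigensystem \<Omega> (elliptic_operator \<Omega> a' q' bc') lam' \<phi>'"
    and "damping_parameters N J c b \<alpha> \<beta> d \<gamma>"
    and "damping_parameters N' J' c' b' \<alpha>' \<beta>' d' \<gamma>'"
    and "laplace_nonvanishing \<sigma>"
    and "\<not> (AE t in lebesgue_on {0<..<T}. \<sigma> t = 0)"
    and "n 1 \<noteq> n 2" and "n' 1 \<noteq> n' 2"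
    and "\<forall>i\<in>{1,2}. lam (n i) = lam' (n' i)"
    and "lam (n 1) \<noteq> lam (n 2)" and "\<forall>i\<in>{1,2}. 0 < lam (n i)"
    and "\<forall>i\<in>{1,2}. observation_functional \<Omega> (D i) (B i) \<and> \<phi> (n i) \<in> D i \<and> B i (\<phi> (n i)) \<noteq> 0"
    and "\<forall>i\<in>{1,2}. observation_functional \<Omega> (D' i) (B' i) \<and> \<phi>' (n' i) \<in> D' i \<and> B' i (\<phi>' (n' i)) \<noteq> 0"
    and "\<forall>i\<in>{1,2}. damped_wave_solution \<Omega> (elliptic_operator \<Omega> a q bc) lam \<phi>
           N J c b \<alpha> \<beta> d \<gamma> T \<sigma> (\<phi> (n i)) (u i)"
    and "\<forall>i\<in>{1,2}. damped_wave_solution \<Omega> (elliptic_operator \<Omega> a' q' bc') lam' \<phi>'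
           N' J' c' b' \<alpha>' \<beta>' d' \<gamma>' T \<sigma> (\<phi>' (n' i)) (u' i)"
    and "\<forall>i\<in>{1,2}. \<forall>t\<in>{0<..<T}. B i (u i t) = B' i (u' i t)"
  shows "N = N' \<and> J = J' \<and> c = c' \<and>
    (\<forall>k\<in>{1..N}. b k = b' k \<and> \<alpha> k = \<alpha>' k \<and> \<beta> k = \<beta>' k) \<and>
    (\<forall>j\<in>{1..J}. d j = d' j \<and> \<gamma> j = \<gamma>' j)"
proof -
  note eig = assms(5) and eig' = assms(6) and par = assms(7) and par' = assms(8)
  have \<sigma>: "laplace_domain \<sigma> \<noteq> {}"
    using assms(9) by (simp add: laplace_nonvanishing_def)
  define E where "E i = damping_symbol (c\<^sup>2 * lam (n i)) N (\<lambda>k. b k * lam (n i) powr \<beta> k) \<alpha> J d \<gamma>" for i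
  \<comment> \<open>Formed with \<open>lam (n i)\<close>, the common eigenvalue, so that both
    symbols contain powers of the same number.\<close>
  define E' where "E' i = damping_symbol (c'\<^sup>2 * lam (n i)) N' (\<lambda>k. b' k * lam (n i) powr \<beta>' k) \<alpha>' J' d' \<gamma>'" for i
  have E: "E i \<mu> = E' i \<mu>" if i: "i \<in> {1, 2}" and "0 \<le> \<mu>" "\<mu> \<le> 3" for i \<mu>
  proof -
    have "E i \<mu> = damping_symbol (c'\<^sup>2 * lam' (n' i)) N' (\<lambda>k. b' k * lam' (n' i) powr \<beta>' k) \<alpha>' J' d' \<gamma>' \<mu>"
      unfolding E_def
      by (rule damping_symbols_agree[where B = "B i" and B' = "B' i" and D = "D i" and D' = "D' i",
            OF assms(18)[rule_format, OF i] assms(19)[rule_format, OF i] eig eig' par par' \<sigma> assms(10)])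
         (use assms(16,17,20) that in blast)+
    moreover have "lam' (n' i) = lam (n i)"
      using assms(13)[rule_format, OF i] by (rule sym)
    ultimately show ?thesis
      by (simp add: E'_def)
  qed
  have orders: "\<forall>k\<in>{1..N}. 0 < \<alpha> k \<and> \<alpha> k \<le> 1" "\<forall>j\<in>{1..J}. 0 < \<gamma> j"
    and orders': "\<forall>k\<in>{1..N'}. 0 < \<alpha>' k \<and> \<alpha>' k \<le> 1" "\<forall>j\<in>{1..J'}. 0 < \<gamma>' j"
    using par par' by (auto simp: damping_parameters_def)
  note E_at = damping_symbol_at[OF orders] damping_symbol_at[OF orders']
  have lam: "0 < lam (n i)" if "i \<in> {1, 2}" for i
    using assms(15) that by blast
  \<comment> \<open>Order 0 carries c^2 \<lambda>; positivity of \<lambda> and of the wave speeds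
    then gives c.\<close>
  have "c\<^sup>2 * lam (n 1) = c'\<^sup>2 * lam (n 1)"
    using E[of 1 0] by (simp add: E_def E'_def E_at(2,6))
  then have "c\<^sup>2 = c'\<^sup>2"
    using lam[of 1] by simp
  then have c: "c = c'"
    using par par' by (simp add: damping_parameters_def power2_eq_iff_nonneg)
  \<comment> \<open>The orders 2 + x with 0 < x \<le> 1 isolate the d_j. These coefficients do not
    involve the eigenvalue, so one experiment suffices.\<close>
  have d_terms: "J = J'" "\<forall>j\<in>{1..J}. \<gamma> j = \<gamma>' j \<and> d j = d' j"
  proof -
    have "(\<Sum>j=1..J. if \<gamma> j = x then d j else 0) = (\<Sum>j=1..J'. if \<gamma>' j = x then d' j else 0)"
      if "x \<in> {0<..1}" for x
      using E[of 1 "2 + x"] that by (simp only: E_def E'_def) (simp add: E_at(4,8))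
    moreover have "strict_mono_on {1..J} \<gamma>" "strict_mono_on {1..J'} \<gamma>'"
      "\<forall>j\<in>{1..J}. d j \<noteq> 0 \<and> \<gamma> j \<in> {0<..1}" "\<forall>j\<in>{1..J'}. d' j \<noteq> 0 \<and> \<gamma>' j \<in> {0<..1}"
      using par par' by (simp_all add: damping_parameters_def)
    ultimately show "J = J'" "\<forall>j\<in>{1..J}. \<gamma> j = \<gamma>' j \<and> d j = d' j"
      using exponent_sum_unique[of J \<gamma> J' \<gamma>' d "{0<..1}" d'] by blast+
  qed
  \<comment> \<open>Orders in (0, 1] yield only the products b_k \<lambda>^\<beta>_k, nonzero
    because \<lambda> > 0; separating the factors takes both experiments.\<close>
  have b_terms: "N = N' \<and> (\<forall>k\<in>{1..N}. \<alpha> k = \<alpha>' k \<and> b k * lam (n i) powr \<beta> k = b' k * lam (n i) powr \<beta>' k)"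
    if i: "i \<in> {1, 2}" for i
  proof -
    have "(\<Sum>k=1..N. if \<alpha> k = x then b k * lam (n i) powr \<beta> k else 0) =
        (\<Sum>k=1..N'. if \<alpha>' k = x then b' k * lam (n i) powr \<beta>' k else 0)"
      if "x \<in> {0<..1}" for x
      using E[OF i, of x] that by (simp only: E_def E'_def) (simp add: E_at(3,7))
    moreover have "strict_mono_on {1..N} \<alpha>" "strict_mono_on {1..N'} \<alpha>'"
      "\<forall>k\<in>{1..N}. b k * lam (n i) powr \<beta> k \<noteq> 0 \<and> \<alpha> k \<in> {0<..1}"
      "\<forall>k\<in>{1..N'}. b' k * lam (n i) powr \<beta>' k \<noteq> 0 \<and> \<alpha>' k \<in> {0<..1}"
      using par par' lam[OF i] by (simp_all add: damping_parameters_def)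
    ultimately show ?thesis
      using exponent_sum_unique[of N \<alpha> N' \<alpha>' "\<lambda>k. b k * lam (n i) powr \<beta> k" "{0<..1}"
          "\<lambda>k. b' k * lam (n i) powr \<beta>' k"] by blast
  qed
  have "b k = b' k \<and> \<beta> k = \<beta>' k" if k: "k \<in> {1..N}" for k
  proof -
    let ?x = "lam (n 1)" and ?y = "lam (n 2)"
    have pos: "0 < ?x" "0 < ?y" using lam by auto
    have b: "b k \<noteq> 0" "b' k \<noteq> 0"
      using par par' b_terms[of 1] k by (auto simp: damping_parameters_def)
    have eq: "b k * ?x powr \<beta> k = b' k * ?x powr \<beta>' k" "b k * ?y powr \<beta> k = b' k * ?y powr \<beta>' k"
      using b_terms[of 1] b_terms[of 2] k by auto
    \<comment> \<open>Dividing the relations for the two eigenvalues eliminates b_k.\<close>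
    then have "(b k * ?x powr \<beta> k) / (b k * ?y powr \<beta> k) = (b' k * ?x powr \<beta>' k) / (b' k * ?y powr \<beta>' k)"
      by simp
    then have "(?x / ?y) powr \<beta> k = (?x / ?y) powr \<beta>' k"
      using b pos by (simp add: powr_divide)
    \<comment> \<open>The ratio of the two eigenvalues is positive and different from 1, so its
      powers determine the exponent.\<close>
    then have \<beta>: "\<beta> k = \<beta>' k"
      using powr_inj[of "?x / ?y"] pos assms(14) by simp
    with eq(1) pos show ?thesis by simp
  qed
  then show ?thesis
    using c d_terms b_terms[of 1] by auto
qed

end
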